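(* Assume that the difference equation $u_{n+1}=A_nu_n$, $n\in\mathbb{N}_0$, has the dichotomy spectrum $\Sigma_{\mathrm{ED}}=\bigcup_{i=1}^{\ell}[\sigma_i^-,\sigma_i^+]$ with fibers $\mathcal{W}_k^i$ and fiber projectors $\mathcal{P}_{k,i}$, $i=1,\ldots,\ell$, $k\in\mathbb{N}_0$. For $s\in\{1,\ldots,d\}$, $n\in\mathbb{N}$ and $V\in\mathcal{G}(s,d)$ let $$a_{1,n}(V)=\sum_{j=1}^{n}\angle\big(\Phi(j-1,0)V,\Phi(j,0)V\big).$$ Then the following holds for all $V\in\mathcal{G}(s,d)$: $$\limsup_{n\to\infty}\frac1n a_{1,n}(V)=\limsup_{n\to\infty}\frac1n a_{1,n}(\mathcal{T}_0(V)),$$ and similarly with $\liminf$ instead of $\limsup$ (on both sides). The upper and lower outer angular values $\hat\theta_s$ and $\underline{\hat\theta}_s$ satisfy $$\hat\theta_s=\sup_{V\in\mathcal{D}_0(s,d)}\limsup_{n\to\infty}\frac1n a_{1,n}(V),\qquad \underline{\hat\theta}_s=\sup_{V\in\mathcal{D}_0(s,d)}\liminf_{n\to\infty}\frac1n a_{1,n}(V).$$ If $\dim(\mathcal{W}_m^i)=1$ for all $i=1,\ldots,d$ and $m\in\mathbb{N}_0$ (so $\ell=d$), then the first lower and upper outer angular values have the form $$\underline{\hat\theta}_1=\max_{i=1,\ldots,d}\liminf_{n\to\infty}\frac1n\sum_{j=1}^{n}\angle(\mathcal{W}_{j-1}^i,\mathcal{W}_j^i),\qquad \hat\theta_1=\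max_{i=1,\ldots,d}\limsup_{n\to\infty}\frac1n\sum_{j=1}^{n}\angle(\mathcal{W}_{j-1}^i,\mathcal{W}_j^i).$$
   Context: Setting: $A_n\in\mathbb{R}^{d,d}$, $n\in\mathbb{N}_0$, are invertible, and $\|A_n\|$, $\|A_n^{-1}\|$ are uniformly bounded in $n$. The solution operator is $\Phi(n,m)=A_{n-1}\cdots A_m$ for $n>m$, $\Phi(n,n)=I$, $\Phi(n,m)=A_n^{-1}\cdots A_{m-1}^{-1}$ for $n<m$. $\|\cdot\|$ is the Euclidean norm of vectors and the associated spectral norm; $\mathcal{R}(P)$ is the range of $P$. $\mathcal{G}(s,d)$ is the Grassmannian of $s$-dimensional subspaces of $\mathbb{R}^d$. For $V,W\in\mathcal{G}(s,d)$, $\angle(V,W)\in[0,\frac{\pi}{2}]$ is the largest principal angle between $V$ and $W$ (its cosine is the smallest singular value of $V_B^\top W_B$, where the columns of $V_B,W_B\in\mathbb{R}^{d,s}$ form orthonormal bases of $V,W$). Outer angular values: the upper resp. lower $s$th outer angular value is $\hat\theta_s=\sup_{V\in\mathcal{G}(s,d)}\limsup_{n\to\infty}\frac1n a_{1,n}(V)$ resp. $\underline{\hat\theta}_s=\sup_{V\in\mathcal{G}(s,d)}\liminf_{n\to\infty}\frac1n a_{1,n}(V)$. Exponential dichotomy (ED) on $\mathbb{N}_0$ of a system with solution operator $\Psi$: there are constants $K>0$, $\alpha_s,\alpha_u\in(0,1)$ and projectors $P_n^s$, $P_n^u=I-P_n^s$ ($n\in\mathbb{N}_0$) with $P_n^{s,u}\Psi(n,m)=\Psi(n,m)P_m^{s,u}$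 for all $n,m$, and $\|\Psi(n,m)P_m^s\|\le K\alpha_s^{n-m}$, $\|\Psi(m,n)P_n^u\|\le K\alpha_u^{n-m}$ for all $n\ge m$. Dichotomy spectrum: $\Sigma_{\mathrm{ED}}=\{\gamma>0: u_{n+1}=\frac1\gamma A_nu_n \text{ has no ED on }\mathbb{N}_0\}$. It is a union of $\ell\le d$ disjoint intervals $[\sigma_i^-,\sigma_i^+]$, $i=1,\ldots,\ell$, with $0<\sigma_\ell^-\le\sigma_\ell^+<\cdots<\sigma_1^-\le\sigma_1^+$. Resolvent intervals: $R_1=(\sigma_1^+,\infty)$, $R_i=(\sigma_i^+,\sigma_{i-1}^-)$ for $i=2,\ldots,\ell+1$, with $\sigma_{\ell+1}^+=0$. Dichotomy projectors: for each $i=1,\ldots,\ell+1$, the scaled systems with $\gamma\in R_i$ have an ED with projectors $P_{n,i}^s$, $P_{n,i}^u=I-P_{n,i}^s$ ($n\in\mathbb{N}_0$) not depending on the choice of $\gamma\in R_i$, which satisfy $P_{n,i}^{s,u}\Phi(n,m)=\Phi(n,m)P_{m,i}^{s,u}$ and, with a constant $K>0$, for all $n\ge m$: $\|\Phi(n,m)P_{m,i}^s\|\le K(\sigma_i^+)^{n-m}$ for $i=1,\ldots,\ell$, and $\|\Phi(m,n)P_{n,i}^u\|\le K(\sigma_{i-1}^-)^{m-n}$ for $i=2,\ldots,\ell+1$. Their ranges form flags: for every $n$, $\{0\}=\mathcal{R}(P_{n,\ell+1}^s)\subseteq\mathcal{R}(P_{n,\ell}^s)\subseteq\cdots\subseteq\mathcal{R}(P_{n,1}^s)=\mathbb{R}^d$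 and $\mathbb{R}^d=\mathcal{R}(P_{n,\ell+1}^u)\supseteq\mathcal{R}(P_{n,\ell}^u)\supseteq\cdots\supseteq\mathcal{R}(P_{n,1}^u)=\{0\}$. Spectral fibers: $\mathcal{W}_n^i=\mathcal{R}(P_{n,i}^s)\cap\mathcal{R}(P_{n,i+1}^u)$, $i=1,\ldots,\ell$; fiber projectors: $\mathcal{P}_{n,i}=P_{n,i}^sP_{n,i+1}^u=P_{n,i+1}^uP_{n,i}^s$, the projector onto $\mathcal{W}_n^i$ along $\bigoplus_{\nu\ne i}\mathcal{W}_n^\nu$. Trace space of $V\in\mathcal{G}(s,d)$ at time $0$: $$\mathcal{T}_0(V)=\bigoplus_{i=1}^{\ell}\mathcal{P}_{0,i}Q_{0,i}^sV=\bigoplus_{i=1}^{\ell}P_{0,i+1}^u\big(\mathcal{R}(P_{0,i}^s)\cap V\big),$$ where $Q_{0,i}^s$ is the orthogonal projector of $\mathbb{R}^d$ onto $\mathcal{R}(P_{0,i}^s)\cap V$; this space has dimension $s$. Set of all trace spaces at time $0$: $\mathcal{D}_0(s,d)$ is the set of all $V\in\mathcal{G}(s,d)$ of the form $V=\bigoplus_{i=1}^{\ell}W_i$ with subspaces $W_i\subseteq\mathcal{W}_0^i$ and $\sum_{i=1}^\ell\dim W_i=s$; equivalently $\mathcal{D}_0(s,d)=\{\mathcal{T}_0(V):V\in\mathcal{G}(s,d)\}$. *)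

theory Defs
  imports
    "Jordan_Normal_Form.Char_Poly"
    "HOL-Library.Set_Algebras"
    "HOL-Analysis.Analysis"
begin

section \<open>The Grassmannian and the largest principal angle\<close>

definition grassmannian :: "nat \<Rightarrow> (real^'d) set set" where
  "grassmannian s = {V. subspace V \<and> dim V = s}"

definition orthonormal_basis :: "nat \<Rightarrow> (real^'d) set \<Rightarrow> (nat \<Rightarrow> real^'d) \<Rightarrow> bool" where
  "orthonormal_basis s V v \<longleftrightarrow>
     (\<forall>i<s. \<forall>j<s. v i \<bullet> v j = (if i = j then 1 else 0)) \<and> span (v ` {..<s}) = V"

text \<open>The matrix \<open>V\<^sub>B\<^sup>T W\<^sub>B\<close> for the matrices \<open>V\<^sub>B\<close>, \<open>W\<^sub>B\<close> with
  columns \<open>v 0, \<dots>, v (s - 1)\<close> and \<open>w 0, \<dots>, w (s - 1)\<close>. Its size \<open>s\<close> is the dimension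
  of a subspace, hence the matrices of \<^typ>\<open>real Matrix.mat\<close>.\<close>

definition cross_gram :: "nat \<Rightarrow> (nat \<Rightarrow> real^'d) \<Rightarrow> (nat \<Rightarrow> real^'d) \<Rightarrow> real Matrix.mat" where
  "cross_gram s v w = Matrix.mat s s (\<lambda>(i, j). v i \<bullet> w j)"

definition smallest_singular_value :: "real Matrix.mat \<Rightarrow> real" where
  "smallest_singular_value M = Min {sqrt \<mu> | \<mu>. eigenvalue (transpose_mat M * M) \<mu>}"

text \<open>The description is proper for subspaces of the same positive dimension: another choice of
  the bases multiplies the matrix from both sides by orthogonal matrices.\<close>

definition angle :: "(real^'d) set \<Rightarrow> (real^'d) set \<Rightarrow> real" where
  "angle V W = (THE \<theta>. 0 \<le> \<theta> \<and> \<theta> \<le> pi / 2 \<and>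
     (\<exists>v w. orthonormal_basis (dim V) V v \<and> orthonormal_basis (dim V) W w \<and>
        cos \<theta> = smallest_singular_value (cross_gram (dim V) v w)))"


section \<open>Linear difference equations and exponential dichotomies\<close>

abbreviation spectral_norm :: "real^'d^'d \<Rightarrow> real" where
  "spectral_norm M \<equiv> onorm ((*v) M)"

definition solution_op :: "(nat \<Rightarrow> real^'d^'d) \<Rightarrow> nat \<Rightarrow> nat \<Rightarrow> real^'d^'d" where
  "solution_op A n m =
     (if m \<le> n then foldr (\<lambda>k X. A k ** X) (rev [m..<n]) (Finite_Cartesian_Product.mat 1)
      else foldr (\<lambda>k X. matrix_inv (A k) ** X) [n..<m] (Finite_Cartesian_Product.mat 1))"

definition compl_proj :: "real^'d^'d \<Rightarrow> real^'d^'d" where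
  "compl_proj Q = Finite_Cartesian_Product.mat 1 - Q"

definition exp_dichotomy ::
    "(nat \<Rightarrow> nat \<Rightarrow> real^'d^'d) \<Rightarrow> (nat \<Rightarrow> real^'d^'d) \<Rightarrow> bool" where
  "exp_dichotomy \<Psi> Ps \<longleftrightarrow>
     (\<forall>n. Ps n ** Ps n = Ps n) \<and>
     (\<forall>n m. Ps n ** \<Psi> n m = \<Psi> n m ** Ps m \<and>
            compl_proj (Ps n) ** \<Psi> n m = \<Psi> n m ** compl_proj (Ps m)) \<and>
     (\<exists>K>0. \<exists>\<alpha>s\<in>{0<..<1}. \<exists>\<alpha>u\<in>{0<..<1}. \<forall>n m. m \<le> n \<longrightarrow>
        spectral_norm (\<Psi> n m ** Ps m) \<le> K * \<alpha>s ^ (n - m) \<and>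
        spectral_norm (\<Psi> m n ** compl_proj (Ps n)) \<le> K * \<alpha>u ^ (n - m))"

definition scaled :: "real \<Rightarrow> (nat \<Rightarrow> real^'d^'d) \<Rightarrow> nat \<Rightarrow> real^'d^'d" where
  "scaled \<gamma> A n = (1 / \<gamma>) *\<^sub>R A n"

definition dichotomy_spectrum :: "(nat \<Rightarrow> real^'d^'d) \<Rightarrow> real set" where
  "dichotomy_spectrum A =
     {\<gamma>. 0 < \<gamma> \<and> \<not> (\<exists>Ps. exp_dichotomy (solution_op (scaled \<gamma> A)) Ps)}"

text \<open>In the following \<open>\<sigma>m i\<close> and \<open>\<sigma>p i\<close>, for \<open>1 \<le> i \<le> l\<close>, are the left and right end points
  of the spectral intervals, numbered from right to left; \<open>\<sigma>p (l + 1) = 0\<close> is part of the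
  convention.\<close>

definition spectral_intervals ::
    "(nat \<Rightarrow> real^'d^'d) \<Rightarrow> nat \<Rightarrow> (nat \<Rightarrow> real) \<Rightarrow> (nat \<Rightarrow> real) \<Rightarrow> bool" where
  "spectral_intervals A l \<sigma>m \<sigma>p \<longleftrightarrow>
     1 \<le> l \<and> l \<le> CARD('d) \<and> \<sigma>p (l + 1) = 0 \<and>
     (\<forall>i\<in>{1..l}. \<sigma>p (i + 1) < \<sigma>m i \<and> \<sigma>m i \<le> \<sigma>p i) \<and>
     dichotomy_spectrum A = (\<Union>i\<in>{1..l}. {\<sigma>m i..\<sigma>p i})"

definition resolvent_interval :: "(nat \<Rightarrow> real) \<Rightarrow> (nat \<Rightarrow> real) \<Rightarrow> nat \<Rightarrow> real set" where
  "resolvent_interval \<sigma>m \<sigma>p i = (if i = 1 then {\<sigma>p 1<..} else {\<sigma>p i<..<\<sigma>m (i - 1)})"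

text \<open>\<open>P n i\<close> is the projector \<open>P\<^sup>s\<close> at time \<open>n\<close> belonging to the \<open>i\<close>-th resolvent interval.
  It does not depend on \<open>\<gamma>\<close>, whereas the dichotomy constants may. On the half line only the ranges
  of the \<open>P n i\<close> are determined by \<open>A\<close>; that the kernels are nested is a condition on the
  choice of the projectors.\<close>

definition dichotomy_projectors ::
    "(nat \<Rightarrow> real^'d^'d) \<Rightarrow> nat \<Rightarrow> (nat \<Rightarrow> real) \<Rightarrow> (nat \<Rightarrow> real) \<Rightarrow>
     (nat \<Rightarrow> nat \<Rightarrow> real^'d^'d) \<Rightarrow> bool" where
  "dichotomy_projectors A l \<sigma>m \<sigma>p P \<longleftrightarrow>
     (\<forall>i\<in>{1..l + 1}. \<forall>\<gamma>\<in>resolvent_interval \<sigma>m \<sigma>p i.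
        exp_dichotomy (solution_op (scaled \<gamma> A)) (\<lambda>n. P n i)) \<and>
     (\<forall>n. range ((*v) (P n (l + 1))) = {0} \<and> range ((*v) (P n 1)) = UNIV \<and>
        (\<forall>i\<in>{1..l}. range ((*v) (P n (i + 1))) \<subseteq> range ((*v) (P n i)))) \<and>
     (\<forall>n. range ((*v) (compl_proj (P n (l + 1)))) = UNIV \<and> range ((*v) (compl_proj (P n 1))) = {0} \<and>
        (\<forall>i\<in>{1..l}. range ((*v) (compl_proj (P n i))) \<subseteq> range ((*v) (compl_proj (P n (i + 1))))))"

definition fiber :: "(nat \<Rightarrow> nat \<Rightarrow> real^'d^'d) \<Rightarrow> nat \<Rightarrow> nat \<Rightarrow> (real^'d) set" where
  "fiber P n i = range ((*v) (P n i)) \<inter> range ((*v) (compl_proj (P n (i + 1))))"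

definition fiber_proj :: "(nat \<Rightarrow> nat \<Rightarrow> real^'d^'d) \<Rightarrow> nat \<Rightarrow> nat \<Rightarrow> real^'d^'d" where
  "fiber_proj P n i = P n i ** compl_proj (P n (i + 1))"


section \<open>Trace spaces\<close>

text \<open>Sums of sets are Minkowski sums, so sums of subspaces are subspaces. The sums below are direct,
  because the summands lie in different fibers. On a subspace \<open>closest_point\<close> is the orthogonal
  projector.\<close>

definition trace_space ::
    "nat \<Rightarrow> (nat \<Rightarrow> nat \<Rightarrow> real^'d^'d) \<Rightarrow> (real^'d) set \<Rightarrow> (real^'d) set" where
  "trace_space l P V =
     (\<Sum>i=1..l. (*v) (fiber_proj P 0 i) ` closest_point (range ((*v) (P 0 i)) \<inter> V) ` V)"

definition trace_spaces ::
    "nat \<Rightarrow> (nat \<Rightarrow> nat \<Rightarrow> real^'d^'d) \<Rightarrow> nat \<Rightarrow> (real^'d) set set" where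
  "trace_spaces l P s = {V \<in> grassmannian s. \<exists>W.
     (\<forall>i\<in>{1..l}. subspace (W i) \<and> W i \<subseteq> fiber P 0 i) \<and>
     V = (\<Sum>i=1..l. W i) \<and> (\<Sum>i=1..l. dim (W i)) = s}"

lemma trace_space_alt:
  assumes P: "dichotomy_projectors A l \<sigma>m \<sigma>p P" and R: "spectral_intervals A l \<sigma>m \<sigma>p"
    and V: "subspace V"
  shows "trace_space l P V =
    (\<Sum>i=1..l. (*v) (compl_proj (P 0 (i + 1))) ` (range ((*v) (P 0 i)) \<inter> V))"
  unfolding trace_space_def
proof (rule sum.cong[OF refl])
  fix i assume i: "i \<in> {1..l}"
  let ?S = "range ((*v) (P 0 i)) \<inter> V"
  have S: "subspace ?S"
    by (intro subspace_inter V linear_subspace_image) (auto simp: matrix_vector_mul_linear)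
  then have "closed ?S" "?S \<noteq> {}"
    using closed_subspace subspace_0 by blast+
  then have Q: "closest_point ?S ` V = ?S"
    using closest_point_in_set[of ?S] closest_point_self[of _ ?S] by (force simp: image_iff)
  have "resolvent_interval \<sigma>m \<sigma>p i \<noteq> {}"
  proof (cases "i = 1")
    case False
    with i have "i - 1 \<in> {1..l}" "i - 1 + 1 = i" by auto
    then have "\<sigma>p i < \<sigma>m (i - 1)"
      using R unfolding spectral_intervals_def by metis
    then show ?thesis using False by (simp add: resolvent_interval_def)
  qed (simp add: resolvent_interval_def)
  then obtain \<gamma> where "\<gamma> \<in> resolvent_interval \<sigma>m \<sigma>p i" by blast
  then have idem: "P 0 i ** P 0 i = P 0 i"
    using P i unfolding dichotomy_projectors_def exp_dichotomy_def by fastforce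
  have fix_range: "P 0 i *v x = x" if "x \<in> range ((*v) (P 0 i))" for x
    using that idem by (auto simp: matrix_vector_mul_assoc)
  have sub: "range ((*v) (P 0 (i + 1))) \<subseteq> range ((*v) (P 0 i))"
    using P i unfolding dichotomy_projectors_def by blast
  have "fiber_proj P 0 i *v x = compl_proj (P 0 (i + 1)) *v x" if "x \<in> ?S" for x
  proof -
    have "P 0 i *v (P 0 (i + 1) *v x) = P 0 (i + 1) *v x"
      using fix_range sub by blast
    moreover have "P 0 i *v x = x" using fix_range that by blast
    ultimately show ?thesis
      by (simp add: fiber_proj_def compl_proj_def matrix_vector_mul_assoc[symmetric]
          matrix_vector_mult_diff_rdistrib matrix_vector_mult_diff_distrib)
  qed
  then show "(*v) (fiber_proj P 0 i) ` closest_point ?S ` V = (*v) (compl_proj (P 0 (i + 1))) ` ?S"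
    unfolding Q by (rule image_cong[OF refl])
qed


section \<open>Outer angular values\<close>

definition angle_sum :: "(nat \<Rightarrow> real^'d^'d) \<Rightarrow> nat \<Rightarrow> (real^'d) set \<Rightarrow> real" where
  "angle_sum A n V =
     (\<Sum>j=1..n. angle ((*v) (solution_op A (j - 1) 0) ` V) ((*v) (solution_op A j 0) ` V))"

definition upper_angular_value :: "(nat \<Rightarrow> real^'d^'d) \<Rightarrow> nat \<Rightarrow> ereal" where
  "upper_angular_value A s =
     (SUP V\<in>grassmannian s. limsup (\<lambda>n. ereal (1 / real n * angle_sum A n V)))"

definition lower_angular_value :: "(nat \<Rightarrow> real^'d^'d) \<Rightarrow> nat \<Rightarrow> ereal" where
  "lower_angular_value A s =
     (SUP V\<in>grassmannian s. liminf (\<lambda>n. ereal (1 / real n * angle_sum A n V)))"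

end

theory Submission
  imports Defs
begin

text \<open>If \<open>V\<close> meets the flag of stable ranges in \<open>V\<^sub>i = V \<inter> range (P 0 i)\<close>, then a vector of the \<open>i\<close>-th
  summand of the trace space lifts to \<open>V\<^sub>i\<close>, and the lifting error lies in the range of the next
  stable projector. The dichotomy in the gap below the \<open>i\<close>-th spectral interval makes this error
  exponentially small relative to the vector under the evolution. Hence the evolved spaces of \<open>V\<close>
  and of its trace space approach each other, so do the successive angles, and the averages have
  the same limit points. The gap \<open>sup {dist(w, V) | w \<in> W, |w| = 1}\<close> is the sine of the largest
  principal angle, and it is simpler to estimate.\<close>

text \<open>A trace vector has components in several fibers, while the lifting error must be small
  relative to the evolved sum of the components. Cancellation in this sum is excluded by the
  projectors at time \<open>n\<close>: they are bounded uniformly in \<open>n\<close>, so each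
  evolved component is at most a constant times the evolved vector. The lifts then add up to one
  time-independent linear map from the trace space onto \<open>V\<close>. Equality of dimensions is
  a by-product: once the relative error is below 1/2, this map annihilates no nonzero trace vector.
  The angle is a definite description over all pairs of orthonormal bases and has to be freed from
  them first. The eigenvalue problem of the Gram matrix becomes one for the quadratic form of the
  orthogonal projector onto \<open>V\<close>, restricted to \<open>W\<close>; minimizing this form
  on the unit sphere gives \<open>arcsin\<close> of the gap. Since \<open>arcsin\<close> has
  unbounded slope at 1, closeness of gaps passes to angles by uniform continuity, without a rate,
  and null sequences are all that the averages require.\<close>

no_notation scalar_prod (infix "\<bullet>" 70)

section \<open>The gap between subspaces\<close>

text \<open>The first argument is the space that approximates. For equal dimensions both orders
  agree, but instead of proving this symmetry the later arguments estimate both orders. For trivial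
  \<open>W\<close> the supremum runs over the empty set, hence the assumptions of positive dimension
  below.\<close>

definition gap :: "'a::euclidean_space set \<Rightarrow> 'a set \<Rightarrow> real" where
  "gap V W = (SUP w\<in>{w \<in> W. norm w = 1}. infdist w V)"

lemma infdist_subspace_le_norm:
  fixes V :: "'a::euclidean_space set"
  assumes "subspace V"
  shows "infdist w V \<le> norm w"
  using infdist_le[OF subspace_0[OF assms], of w] by simp

lemma infdist_subspace_nearest:
  fixes V :: "'a::euclidean_space set"
  assumes "subspace V"
  obtains v where "v \<in> V" "norm (w - v) = infdist w V"
  using infdist_attains_inf[OF closed_subspace[OF assms], of w] subspace_0[OF assms]
  by (metis dist_norm empty_iff)

lemma infdist_subspace_scaleR:
  fixes V :: "'a::euclidean_space set"
  assumes V: "subspace V"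
  shows "infdist (c *\<^sub>R w) V = \<bar>c\<bar> * infdist w V"
proof (cases "c = 0")
  case True
  then show ?thesis using subspace_0[OF V] by simp
next
  case False
  have le: "infdist (c *\<^sub>R w) V \<le> \<bar>c\<bar> * infdist w V" for c w
  proof -
    obtain v where v: "v \<in> V" "norm (w - v) = infdist w V"
      by (rule infdist_subspace_nearest[OF V])
    have "infdist (c *\<^sub>R w) V \<le> dist (c *\<^sub>R w) (c *\<^sub>R v)"
      by (intro infdist_le subspace_scale V v)
    also have "\<dots> = \<bar>c\<bar> * infdist w V"
      using v(2) by (simp add: dist_norm flip: scaleR_diff_right)
    finally show ?thesis .
  qed
  have "\<bar>c\<bar> * infdist w V \<le> \<bar>c\<bar> * (\<bar>1 / c\<bar> * infdist (c *\<^sub>R w) V)"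
    using le[of "1 / c" "c *\<^sub>R w"] False by (intro mult_left_mono) auto
  also have "\<dots> = infdist (c *\<^sub>R w) V"
    using False by simp
  finally show ?thesis using le[of c w] by linarith
qed

lemma gap_bdd_above:
  fixes V W :: "'a::euclidean_space set"
  assumes V: "subspace V"
  shows "bdd_above ((\<lambda>w. infdist w V) ` {w \<in> W. norm w = 1})"
  by (rule bdd_aboveI2[of _ _ 1]) (metis (mono_tags) V infdist_subspace_le_norm mem_Collect_eq)

lemma infdist_le_gap:
  fixes V W :: "'a::euclidean_space set"
  assumes V: "subspace V" and W: "subspace W" and w: "w \<in> W"
  shows "infdist w V \<le> gap V W * norm w"
proof (cases "w = 0")
  case True
  then show ?thesis using subspace_0[OF V] by simp
next
  case False
  let ?e = "(1 / norm w) *\<^sub>R w"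
  have "infdist ?e V \<le> gap V W"
    unfolding gap_def using False w W
    by (intro cSUP_upper gap_bdd_above V) (auto intro: subspace_scale)
  then show ?thesis using False by (simp add: infdist_subspace_scaleR[OF V] field_simps)
qed

lemma unit_vector_in_subspace:
  fixes W :: "'a::euclidean_space set"
  assumes W: "subspace W" and "0 < dim W"
  obtains w where "w \<in> W" "norm w = 1"
proof -
  obtain x where x: "x \<in> W" "x \<noteq> 0"
    using assms(2) dim_eq_0[of W] by fastforce
  show thesis
    by (rule that[of "(1 / norm x) *\<^sub>R x"]) (use x W in \<open>auto intro: subspace_scale\<close>)
qed

lemma gap_le:
  fixes V W :: "'a::euclidean_space set"
  assumes "subspace W" "0 < dim W" and le: "\<And>w. w \<in> W \<Longrightarrow> infdist w V \<le> c * norm w"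
  shows "gap V W \<le> c"
  unfolding gap_def
proof (rule cSUP_least)
  show "{w \<in> W. norm w = 1} \<noteq> {}"
    using unit_vector_in_subspace[OF assms(1,2)] by blast
qed (use le in fastforce)

lemma gap_nonneg:
  fixes V W :: "'a::euclidean_space set"
  assumes "subspace V" "subspace W" "0 < dim W"
  shows "0 \<le> gap V W"
proof -
  obtain w where w: "w \<in> W" "norm w = 1"
    by (rule unit_vector_in_subspace[OF assms(2,3)])
  show ?thesis using infdist_le_gap[OF assms(1,2) w(1)] w(2) infdist_nonneg[of w V] by simp
qed

lemma gap_le_1:
  fixes V W :: "'a::euclidean_space set"
  assumes "subspace V" "subspace W" "0 < dim W"
  shows "gap V W \<le> 1"
  using gap_le[OF assms(2,3), of V 1] infdist_subspace_le_norm[OF assms(1)] by simp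

text \<open>A unit vector of \<open>W\<close> is moved to \<open>W'\<close>, then to
  \<open>V'\<close>, then to \<open>V\<close>, each time to a nearest point. The coefficient 1 of
  \<open>gap V' W'\<close> is essential, since it makes differences of gaps small; the constants 2
  and 4 come from the crude bounds that a nearest point at most doubles the norm.\<close>

lemma gap_perturb:
  fixes V W V' W' :: "'a::euclidean_space set"
  assumes V: "subspace V" and W: "subspace W" and V': "subspace V'" and W': "subspace W'"
    and d: "0 < dim W" "0 < dim W'" "0 < dim V'"
  shows "gap V W \<le> gap V' W' + 2 * gap W' W + 4 * gap V V'"
proof (rule gap_le[OF W d(1)])
  fix w assume w: "w \<in> W"
  obtain w' where w': "w' \<in> W'" "norm (w - w') = infdist w W'"
    by (rule infdist_subspace_nearest[OF W'])
  obtain v' where v': "v' \<in> V'" "norm (w' - v') = infdist w' V'"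
    by (rule infdist_subspace_nearest[OF V'])
  obtain v where v: "v \<in> V" "norm (v' - v) = infdist v' V"
    by (rule infdist_subspace_nearest[OF V])
  have a: "norm (w - w') \<le> gap W' W * norm w"
    using infdist_le_gap[OF W' W w] w'(2) by simp
  have b: "norm (w' - v') \<le> gap V' W' * norm w'"
    using infdist_le_gap[OF V' W' w'(1)] v'(2) by simp
  have c: "norm (v' - v) \<le> gap V V' * norm v'"
    using infdist_le_gap[OF V V' v'(1)] v(2) by simp
  have nw': "norm w' \<le> norm w + gap W' W * norm w"
    using a norm_triangle_ineq2[of w' w] by (simp add: norm_minus_commute)
  have g: "0 \<le> gap W' W" "gap W' W \<le> 1" "0 \<le> gap V' W'" "gap V' W' \<le> 1" "0 \<le> gap V V'"
    using gap_nonneg gap_le_1 assms by blast+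
  \<comment> \<open>The excess of \<open>norm w'\<close> over \<open>norm w\<close> is charged to
    \<open>gap W' W\<close>, using \<open>gap V' W' \<le> 1\<close>. This is the second copy of
    \<open>gap W' W\<close>.\<close>
  have 1: "gap V' W' * norm w' \<le> gap V' W' * norm w + gap W' W * norm w"
  proof -
    have "gap V' W' * norm w' \<le> gap V' W' * (norm w + gap W' W * norm w)"
      using nw' g by (intro mult_left_mono)
    also have "\<dots> \<le> gap V' W' * norm w + 1 * (gap W' W * norm w)"
      using mult_right_mono[OF g(4), of "gap W' W * norm w"] g by (simp add: algebra_simps)
    finally show ?thesis by simp
  qed
  have "norm v' \<le> 4 * norm w"
  proof -
    have "norm v' \<le> norm w' + infdist w' V'"
      using v'(2) norm_triangle_ineq2[of v' w'] by (simp add: norm_minus_commute)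
    also have "\<dots> \<le> 2 * norm w'"
      using infdist_subspace_le_norm[OF V'] by simp
    also have "norm w' \<le> 2 * norm w"
      using nw' mult_right_mono[OF g(2) norm_ge_zero[of w]] by simp
    finally show ?thesis by simp
  qed
  then have 2: "gap V V' * norm v' \<le> 4 * gap V V' * norm w"
    using mult_left_mono[of "norm v'" "4 * norm w" "gap V V'"] g by simp
  have "infdist w V \<le> norm (w - v)"
    using infdist_le[OF v(1), of w] by (simp add: dist_norm)
  also have "\<dots> \<le> norm (w - w') + norm (w' - v') + norm (v' - v)"
    using norm_triangle_ineq[of "w - w'" "w' - v'"] norm_triangle_ineq[of "w - v'" "v' - v"] by simp
  also have "\<dots> \<le> (gap V' W' + 2 * gap W' W + 4 * gap V V') * norm w"
    using a b c 1 2 by (simp add: algebra_simps)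
  finally show "infdist w V \<le> (gap V' W' + 2 * gap W' W + 4 * gap V V') * norm w" .
qed

section \<open>The largest principal angle\<close>

lemma ex_orthonormal_basis:
  fixes V :: "(real^'d) set"
  assumes V: "subspace V"
  shows "\<exists>v. orthonormal_basis (dim V) V v"
proof -
  obtain B where B: "B \<subseteq> V" "pairwise orthogonal B" "\<And>x. x \<in> B \<Longrightarrow> norm x = 1"
      "independent B" "card B = dim V" "span B = V"
    using orthonormal_basis_subspace[OF V] by blast
  have "finite B" using B(4) by (rule independent_imp_finite)
  then obtain f where f: "bij_betw f {..<dim V} B"
    using ex_bij_betw_nat_finite[of B] B(5) by (auto simp: atLeast0LessThan)
  have im: "f ` {..<dim V} = B" using f by (simp add: bij_betw_def)
  have "f i \<bullet> f j = (if i = j then 1 else 0)" if "i < dim V" "j < dim V" for i j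
  proof (cases "i = j")
    case True
    then show ?thesis using B(3) im that by (auto simp: dot_square_norm)
  next
    case False
    then have "f i \<noteq> f j" using f that unfolding bij_betw_def inj_on_def by blast
    then show ?thesis
      using B(2) im that False by (auto simp: pairwise_def orthogonal_def)
  qed
  then show ?thesis unfolding orthonormal_basis_def using im B(6) by blast
qed

lemma orthonormal_basis_mem:
  "orthonormal_basis s V v \<Longrightarrow> i < s \<Longrightarrow> v i \<in> V"
  unfolding orthonormal_basis_def by (metis imageI lessThan_iff span_base)

lemma orthonormal_basis_inner_combination:
  assumes "orthonormal_basis s V v" "j < s"
  shows "v j \<bullet> (\<Sum>i<s. c i *\<^sub>R v i) = c j"
proof -
  have "v j \<bullet> (\<Sum>i<s. c i *\<^sub>R v i) = (\<Sum>i<s. if i = j then c i else 0)"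
    unfolding inner_sum_right
    using assms by (intro sum.cong) (auto simp: orthonormal_basis_def)
  then show ?thesis using assms(2) by simp
qed

lemma orthonormal_basis_expansion:
  assumes b: "orthonormal_basis s V v" and x: "x \<in> V"
  shows "(\<Sum>i<s. (v i \<bullet> x) *\<^sub>R v i) = x"
proof -
  let ?E = "{x. (\<Sum>i<s. (v i \<bullet> x) *\<^sub>R v i) = x}"
  have "x \<in> span (v ` {..<s})" using b x by (simp add: orthonormal_basis_def)
  moreover have "subspace ?E"
    by (auto simp: subspace_def inner_add_right scaleR_add_left sum.distrib
        simp flip: scaleR_scaleR scaleR_sum_right)
  moreover have "v ` {..<s} \<subseteq> ?E"
  proof safe
    fix j assume "j < s"
    then have "(\<Sum>i<s. (v i \<bullet> v j) *\<^sub>R v i) = (\<Sum>i<s. if i = j then v i else 0)"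
      using b by (intro sum.cong) (auto simp: orthonormal_basis_def)
    then show "(\<Sum>i<s. (v i \<bullet> v j) *\<^sub>R v i) = v j" using \<open>j < s\<close> by simp
  qed
  ultimately show ?thesis using span_minimal by blast
qed

lemma orthonormal_basis_imp_subspace: "orthonormal_basis s V v \<Longrightarrow> subspace V"
  unfolding orthonormal_basis_def by (metis subspace_span)

text \<open>For an orthonormal basis \<open>v\<close> of \<open>V\<close> this is the bilinear form
  \<open>x \<bullet> Q y\<close> of the orthogonal projector \<open>Q\<close> onto \<open>V\<close>.
  Restricted to \<open>W\<close>, it has the matrix of the angle definition, transpose times cross
  Gram matrix, in an orthonormal basis \<open>w\<close> of \<open>W\<close>.\<close>

definition basis_form :: "nat \<Rightarrow> (nat \<Rightarrow> real^'d) \<Rightarrow> real^'d \<Rightarrow> real^'d \<Rightarrow> real" where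
  "basis_form s v x y = (\<Sum>i<s. (v i \<bullet> x) * (v i \<bullet> y))"

lemma basis_form_simps:
  "basis_form s v x (y + z) = basis_form s v x y + basis_form s v x z"
  "basis_form s v (y + z) x = basis_form s v y x + basis_form s v z x"
  "basis_form s v x (c *\<^sub>R y) = c * basis_form s v x y"
  "basis_form s v (c *\<^sub>R y) x = c * basis_form s v y x"
  "basis_form s v x 0 = 0"
  by (simp_all add: basis_form_def inner_add_right algebra_simps sum.distrib sum_distrib_left)

lemma basis_form_commute: "basis_form s v x y = basis_form s v y x"
  by (simp add: basis_form_def mult.commute)

text \<open>Pythagoras: the basis expansion \<open>y\<close> is the orthogonal projection of
  \<open>x\<close>, and its squared length is the value of the form. Maximizing the distance to
  \<open>V\<close> over unit vectors thus means minimizing the form.\<close>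

lemma infdist_sq_basis_form:
  assumes b: "orthonormal_basis s V v"
  shows "(infdist x V)\<^sup>2 = x \<bullet> x - basis_form s v x x"
proof -
  define y where "y = (\<Sum>i<s. (v i \<bullet> x) *\<^sub>R v i)"
  have V: "subspace V" by (rule orthonormal_basis_imp_subspace[OF b])
  have y: "y \<in> V"
    unfolding y_def by (intro subspace_sum subspace_scale V orthonormal_basis_mem[OF b]) auto
  have vy: "v i \<bullet> y = v i \<bullet> x" if "i < s" for i
    unfolding y_def by (rule orthonormal_basis_inner_combination[OF b that])
  have inner_y: "z \<bullet> y = basis_form s v z x" for z
    unfolding y_def basis_form_def inner_sum_right by (simp add: inner_commute mult.commute)
  have orth: "(x - y) \<bullet> z = 0" if "z \<in> V" for z
  proof -
    have "(x - y) \<bullet> v i = 0" if "i < s" for i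
      using vy[OF that] by (subst inner_commute) (simp add: inner_diff_right)
    then have "(x - y) \<bullet> (\<Sum>i<s. (v i \<bullet> z) *\<^sub>R v i) = 0"
      by (simp add: inner_sum_right)
    then show ?thesis using orthonormal_basis_expansion[OF b that] by simp
  qed
  have "infdist x V = norm (x - y)"
  proof (rule antisym)
    show "infdist x V \<le> norm (x - y)" using infdist_le[OF y, of x] by (simp add: dist_norm)
    obtain z where z: "z \<in> V" "norm (x - z) = infdist x V"
      by (rule infdist_subspace_nearest[OF V])
    have "(norm (x - y))\<^sup>2 \<le> (norm (x - y))\<^sup>2 + (norm (y - z))\<^sup>2" by simp
    also have "\<dots> = (norm ((x - y) + (y - z)))\<^sup>2"
      using orth[of "y - z"] y z(1) V
      by (intro norm_add_Pythagorean[symmetric]) (auto simp: orthogonal_def subspace_diff)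
    finally have "norm (x - y) \<le> norm (x - z)"
      by (simp add: abs_le_square_iff[symmetric])
    then show "norm (x - y) \<le> infdist x V" unfolding z(2) .
  qed
  then have "(infdist x V)\<^sup>2 = (x - y) \<bullet> (x - y)" by (simp add: power2_norm_eq_inner)
  also have "\<dots> = (x - y) \<bullet> x" using orth[OF y] by (simp add: inner_diff_right)
  also have "\<dots> = x \<bullet> x - basis_form s v x x"
    by (simp add: inner_diff_left inner_commute[of y] inner_y)
  finally show ?thesis .
qed

text \<open>The coordinate vector \<open>a\<close> stands for the combination of the
  \<open>w k\<close> with these coefficients; the matrix product then tests the form of this vector
  against each \<open>w j\<close>.\<close>

lemma cross_gram_mult_vec:
  assumes "a \<in> carrier_vec s"
  shows "(transpose_mat (cross_gram s v w) * cross_gram s v w) *\<^sub>v a =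
     Matrix.vec s (\<lambda>j. basis_form s v (w j) (\<Sum>k<s. vec_index a k *\<^sub>R w k))"
proof -
  let ?M = "cross_gram s v w" and ?x = "\<Sum>k<s. vec_index a k *\<^sub>R w k"
  have M: "?M \<in> carrier_mat s s" by (simp add: cross_gram_def)
  have Ma: "?M *\<^sub>v a = Matrix.vec s (\<lambda>i. v i \<bullet> ?x)"
    using assms by (intro eq_vecI)
      (auto simp: cross_gram_def scalar_prod_def inner_sum_right atLeast0LessThan mult.commute)
  have "(transpose_mat ?M * ?M) *\<^sub>v a = transpose_mat ?M *\<^sub>v (?M *\<^sub>v a)"
    using M assms by (intro assoc_mult_mat_vec[of _ s s _ s]) auto
  also have "\<dots> = Matrix.vec s (\<lambda>j. basis_form s v (w j) ?x)"
    unfolding Ma by (intro eq_vecI)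
      (auto simp: cross_gram_def scalar_prod_def basis_form_def atLeast0LessThan)
  finally show ?thesis .
qed

text \<open>An equation tested against the basis vectors \<open>w j\<close> extends to all of
  \<open>W\<close> by linearity. The right-hand side no longer mentions \<open>w\<close>, which is
  half of the independence of bases; the other half is \<open>infdist_sq_basis_form\<close>.\<close>

lemma eigenvalue_cross_gram_iff:
  assumes w: "orthonormal_basis s W w"
  shows "eigenvalue (transpose_mat (cross_gram s v w) * cross_gram s v w) \<mu> \<longleftrightarrow>
    (\<exists>x\<in>W. x \<noteq> 0 \<and> (\<forall>u\<in>W. basis_form s v u x = \<mu> * (u \<bullet> x)))" (is "?l \<longleftrightarrow> ?r")
proof
  have W: "subspace W" by (rule orthonormal_basis_imp_subspace[OF w])
  have dimr: "dim_row (transpose_mat (cross_gram s v w) * cross_gram s v w) = s"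
    by (simp add: cross_gram_def)
  show ?r if ?l
  proof -
    obtain a where a: "a \<in> carrier_vec s" "a \<noteq> 0\<^sub>v s"
      and eq: "(transpose_mat (cross_gram s v w) * cross_gram s v w) *\<^sub>v a = \<mu> \<cdot>\<^sub>v a"
      using \<open>?l\<close> unfolding eigenvalue_def eigenvector_def dimr by blast
    let ?x = "\<Sum>k<s. vec_index a k *\<^sub>R w k"
    have wx: "w j \<bullet> ?x = vec_index a j" if "j < s" for j
      by (rule orthonormal_basis_inner_combination[OF w that])
    have ev: "basis_form s v (w j) ?x = \<mu> * (w j \<bullet> ?x)" if "j < s" for j
      using arg_cong[OF eq, of "\<lambda>b. vec_index b j"] that a(1)
      unfolding cross_gram_mult_vec[OF a(1)] by (simp add: wx)
    have "basis_form s v u ?x = \<mu> * (u \<bullet> ?x)" if "u \<in> W" for u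
    proof -
      have "subspace {u. basis_form s v u ?x = \<mu> * (u \<bullet> ?x)}"
        by (auto simp: subspace_def basis_form_simps basis_form_commute[of s v 0]
            inner_add_left algebra_simps)
      moreover have "w ` {..<s} \<subseteq> {u. basis_form s v u ?x = \<mu> * (u \<bullet> ?x)}"
        using ev by auto
      ultimately have "span (w ` {..<s}) \<subseteq> {u. basis_form s v u ?x = \<mu> * (u \<bullet> ?x)}"
        by (intro span_minimal)
      then show ?thesis using w that unfolding orthonormal_basis_def by blast
    qed
    moreover have "?x \<in> W"
      by (intro subspace_sum subspace_scale W orthonormal_basis_mem[OF w]) auto
    moreover have "?x \<noteq> 0"
    proof
      assume "?x = 0"
      then have "a = 0\<^sub>v s" using wx a(1) by (intro eq_vecI) auto
      then show False using a(2) by simp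
    qed
    ultimately show ?thesis by blast
  qed
  show ?l if ?r
  proof -
    obtain x where x: "x \<in> W" "x \<noteq> 0" "\<And>u. u \<in> W \<Longrightarrow> basis_form s v u x = \<mu> * (u \<bullet> x)"
      using \<open>?r\<close> by blast
    let ?a = "Matrix.vec s (\<lambda>k. w k \<bullet> x)"
    have ex: "(\<Sum>k<s. vec_index ?a k *\<^sub>R w k) = x"
      using orthonormal_basis_expansion[OF w x(1)] by simp
    have "?a \<noteq> 0\<^sub>v s"
    proof
      assume "?a = 0\<^sub>v s"
      then have "(\<Sum>k<s. vec_index ?a k *\<^sub>R w k) = 0" by simp
      then show False using ex x(2) by simp
    qed
    moreover have "(transpose_mat (cross_gram s v w) * cross_gram s v w) *\<^sub>v ?a = \<mu> \<cdot>\<^sub>v ?a"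
      by (subst cross_gram_mult_vec[where s = s])
         (auto simp only: ex vec_carrier, intro eq_vecI, auto simp: x(3) orthonormal_basis_mem[OF w])
    ultimately show ?thesis
      unfolding eigenvalue_def eigenvector_def dimr by (intro exI[of _ ?a]) simp
  qed
qed

lemma finite_eigenvalue_cross_gram:
  "finite {\<mu>. eigenvalue (transpose_mat (cross_gram s v w) * cross_gram s v w) \<mu>}"
proof -
  let ?N = "transpose_mat (cross_gram s v w) * cross_gram s v w"
  have N: "?N \<in> carrier_mat s s" by (rule carrier_matI) (simp_all add: cross_gram_def)
  have "char_poly ?N \<noteq> 0" using degree_monic_char_poly[OF N] by auto
  then show ?thesis unfolding eigenvalue_root_char_poly[OF N] by (rule poly_roots_finite)
qed

text \<open>Rayleigh quotients: by compactness the form attains its minimum \<open>m\<close> on the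
  unit sphere of \<open>W\<close>; the minimizer is an eigenvector by the first-order condition, and
  every eigenvalue is a value of the quotient, hence at least \<open>m\<close>.\<close>

lemma smallest_singular_value_cross_gram:
  assumes v: "orthonormal_basis s V v" and w: "orthonormal_basis s W w" and d: "0 < dim W"
  shows "smallest_singular_value (cross_gram s v w) = sqrt (1 - (gap V W)\<^sup>2)"
proof -
  have V: "subspace V" and W: "subspace W"
    using v w orthonormal_basis_imp_subspace by blast+
  let ?S = "{x \<in> W. norm x = 1}"
  obtain e where e: "e \<in> W" "norm e = 1" by (rule unit_vector_in_subspace[OF W d])
  have "?S = W \<inter> sphere 0 1" by auto
  then have "compact ?S" using closed_subspace[OF W] compact_Int_closed[of "sphere 0 1" W]
    by (simp add: Int_commute)
  moreover have "?S \<noteq> {}" using e by blast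
  moreover have "continuous_on ?S (\<lambda>x. infdist x V)" by (intro continuous_intros)
  ultimately obtain x where x: "x \<in> ?S" "\<And>y. y \<in> ?S \<Longrightarrow> infdist y V \<le> infdist x V"
    using continuous_attains_sup[of ?S "\<lambda>x. infdist x V"] by blast
  have gx: "gap V W = infdist x V"
    unfolding gap_def using x by (intro cSup_eq_maximum) auto
  define m where "m = 1 - (gap V W)\<^sup>2"
  have xx: "x \<bullet> x = 1" using x(1) by (simp add: dot_square_norm)
  have mx: "basis_form s v x x = m"
    using infdist_sq_basis_form[OF v, of x] gx xx by (simp add: m_def)
  have low: "m * (y \<bullet> y) \<le> basis_form s v y y" if "y \<in> W" for y
  proof -
    have "(infdist y V)\<^sup>2 \<le> (gap V W * norm y)\<^sup>2"
      by (intro power_mono infdist_le_gap V W that infdist_nonneg)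
    then show ?thesis
      using infdist_sq_basis_form[OF v, of y]
      by (simp add: m_def power_mult_distrib power2_norm_eq_inner algebra_simps)
  qed
  \<comment> \<open>First-order condition at the minimizer: along \<open>x + t *\<^sub>R u\<close>
    the excess of the form over \<open>m\<close> times the squared norm is
    \<open>2 * t * b + t\<^sup>2 * c\<close>. It is nonnegative for all \<open>t\<close>, which
    forces \<open>b = 0\<close>.\<close>
  have crit: "basis_form s v u x = m * (u \<bullet> x)" if u: "u \<in> W" for u
  proof -
    define b where "b = basis_form s v u x - m * (u \<bullet> x)"
    define c where "c = basis_form s v u u - m * (u \<bullet> u)"
    have q: "0 \<le> 2 * t * b + t\<^sup>2 * c" for t
    proof -
      have "x + t *\<^sub>R u \<in> W" using x(1) u W by (auto intro: subspace_add subspace_scale)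
      from low[OF this] show ?thesis
        using mx xx
        by (simp add: basis_form_simps b_def c_def basis_form_commute[of s v x u]
            inner_add_left inner_add_right inner_commute[of x u] power2_eq_square algebra_simps)
    qed
    have "c \<ge> 0" using low[OF u] by (simp add: c_def)
    have "b = 0"
    proof (rule ccontr)
      assume "b \<noteq> 0"
      \<comment> \<open>The denominator is \<open>c + 1\<close> because \<open>c\<close> may vanish.
        This \<open>t\<close> gives the quadratic the negative value
        \<open>- (t\<^sup>2 * (c + 2))\<close>.\<close>
      define t where "t = - b / (c + 1)"
      have b: "b = - (t * (c + 1))" and "t \<noteq> 0"
        using \<open>c \<ge> 0\<close> \<open>b \<noteq> 0\<close> by (auto simp: t_def)
      have "2 * t * b + t\<^sup>2 * c = - (t\<^sup>2 * (c + 2))"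
        unfolding b by (simp add: power2_eq_square algebra_simps)
      moreover have "0 < t\<^sup>2 * (c + 2)" using \<open>c \<ge> 0\<close> \<open>t \<noteq> 0\<close> by simp
      ultimately show False using q[of t] by linarith
    qed
    then show ?thesis by (simp add: b_def)
  qed
  let ?N = "transpose_mat (cross_gram s v w) * cross_gram s v w"
  have "eigenvalue ?N m"
    unfolding eigenvalue_cross_gram_iff[OF w]
    using crit x(1) by (intro bexI[of _ x]) auto
  moreover have "m \<le> \<mu>" if "eigenvalue ?N \<mu>" for \<mu>
  proof -
    obtain y where y: "y \<in> W" "y \<noteq> 0" "basis_form s v y y = \<mu> * (y \<bullet> y)"
      using \<open>eigenvalue ?N \<mu>\<close> unfolding eigenvalue_cross_gram_iff[OF w] by blast
    then show ?thesis using low[OF y(1)] by simp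
  qed
  ultimately have "Min {sqrt \<mu> | \<mu>. eigenvalue ?N \<mu>} = sqrt m"
    using finite_eigenvalue_cross_gram[of s v w]
    by (intro Min_eqI) (auto simp: Setcompr_eq_image)
  then show ?thesis by (simp add: smallest_singular_value_def m_def)
qed

text \<open>Every pair of orthonormal bases yields the same cosine
  \<open>sqrt (1 - (gap V W)\<^sup>2)\<close>, and \<open>cos\<close> is injective on the admissible
  interval. So the definite description has exactly one candidate.\<close>

lemma angle_eq_arcsin_gap:
  fixes V W :: "(real^'d) set"
  assumes V: "subspace V" and W: "subspace W" and d: "dim V = dim W" "0 < dim W"
  shows "angle V W = arcsin (gap V W)"
proof -
  have g: "0 \<le> gap V W" "gap V W \<le> 1"
    using gap_nonneg[OF V W d(2)] gap_le_1[OF V W d(2)] by auto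
  obtain v w where v: "orthonormal_basis (dim V) V v" and w: "orthonormal_basis (dim V) W w"
    using ex_orthonormal_basis[OF V] ex_orthonormal_basis[OF W] d(1) by metis
  have cos: "cos (arcsin (gap V W)) = sqrt (1 - (gap V W)\<^sup>2)"
    using g by (intro cos_arcsin) auto
  have arcs: "0 \<le> arcsin (gap V W)" "arcsin (gap V W) \<le> pi / 2"
    using g arcsin_bounded[of "gap V W"] arcsin_le_arcsin[of 0 "gap V W"] by auto
  show ?thesis
    unfolding angle_def
  proof (rule the_equality)
    show "0 \<le> arcsin (gap V W) \<and> arcsin (gap V W) \<le> pi / 2 \<and>
      (\<exists>v w. orthonormal_basis (dim V) V v \<and> orthonormal_basis (dim V) W w \<and>
        cos (arcsin (gap V W)) = smallest_singular_value (cross_gram (dim V) v w))"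
    proof (intro conjI)
      show "0 \<le> arcsin (gap V W)" "arcsin (gap V W) \<le> pi / 2"
        using arcs by auto
    next
      show "\<exists>v w. orthonormal_basis (dim V) V v \<and> orthonormal_basis (dim V) W w \<and>
        cos (arcsin (gap V W)) = smallest_singular_value (cross_gram (dim V) v w)"
        using v w cos smallest_singular_value_cross_gram[OF v w d(2)]
        by (rule_tac x = v in exI, rule_tac x = w in exI) simp
    qed
  next
    fix \<theta> assume \<theta>: "0 \<le> \<theta> \<and> \<theta> \<le> pi / 2 \<and>
      (\<exists>v w. orthonormal_basis (dim V) V v \<and> orthonormal_basis (dim V) W w \<and>
        cos \<theta> = smallest_singular_value (cross_gram (dim V) v w))"
    then obtain v' w' where "orthonormal_basis (dim V) V v'" "orthonormal_basis (dim V) W w'"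
        "cos \<theta> = smallest_singular_value (cross_gram (dim V) v' w')"
      by blast
    then have "cos \<theta> = cos (arcsin (gap V W))"
      using smallest_singular_value_cross_gram[of "dim V" V v' W w'] d(2) cos by simp
    then show "\<theta> = arcsin (gap V W)"
      using cos_inj_pi[of \<theta> "arcsin (gap V W)"] conjunct1[OF \<theta>] conjunct1[OF conjunct2[OF \<theta>]]
        arcs pi_gt_zero by simp
  qed
qed

section \<open>Averages of angles\<close>

lemma cesaro_null:
  fixes f :: "nat \<Rightarrow> real"
  assumes f: "f \<longlonglongrightarrow> 0"
  shows "(\<lambda>n. 1 / real n * (\<Sum>j=1..n. f j)) \<longlonglongrightarrow> 0"
proof (rule LIMSEQ_I)
  fix e :: real assume e: "0 < e"
  then obtain N where N: "\<And>j. j \<ge> N \<Longrightarrow> \<bar>f j\<bar> < e / 2"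
    using LIMSEQ_D[OF f, of "e / 2"] by auto
  define S where "S = (\<Sum>j\<le>N. \<bar>f j\<bar>)"
  \<comment> \<open>The terms beyond \<open>N\<close> contribute at most \<open>n * (e / 2)\<close>;
    the head sum \<open>S\<close> is smaller than that as soon as \<open>n > 2 * S / e\<close>. The
    successor also makes \<open>n\<close> positive.\<close>
  have "norm (1 / real n * (\<Sum>j=1..n. f j) - 0) < e" if n: "n \<ge> Suc (nat \<lceil>2 * S / e\<rceil>)" for n
  proof -
    have "\<bar>\<Sum>j=1..n. f j\<bar> \<le> (\<Sum>j=1..n. \<bar>f j\<bar>)" by (rule sum_abs)
    also have "\<dots> \<le> (\<Sum>j=1..n. (if j \<le> N then \<bar>f j\<bar> else 0) + e / 2)"
      using N e by (intro sum_mono) (auto simp: less_imp_le)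
    also have "\<dots> = (\<Sum>j\<in>{1..n} \<inter> {..N}. \<bar>f j\<bar>) + real n * (e / 2)"
      by (simp add: sum.distrib sum.If_cases Int_def)
    also have "(\<Sum>j\<in>{1..n} \<inter> {..N}. \<bar>f j\<bar>) \<le> S"
      unfolding S_def by (intro sum_mono2) auto
    finally have "\<bar>\<Sum>j=1..n. f j\<bar> \<le> S + real n * (e / 2)" by simp
    moreover have "2 * S / e < real n" using n by linarith
    then have "S < real n * (e / 2)" using e by (simp add: field_simps)
    ultimately have "\<bar>\<Sum>j=1..n. f j\<bar> < real n * e" by linarith
    moreover have "0 < n" using n by simp
    ultimately show ?thesis by (simp add: abs_mult field_simps)
  qed
  then show "\<exists>no. \<forall>n\<ge>no. norm (1 / real n * (\<Sum>j=1..n. f j) - 0) < e" by blast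
qed

lemma limsup_liminf_eq_if_diff_null:
  fixes x y :: "nat \<Rightarrow> real"
  assumes "(\<lambda>n. x n - y n) \<longlonglongrightarrow> 0"
  shows "limsup (\<lambda>n. ereal (x n)) = limsup (\<lambda>n. ereal (y n))"
    and "liminf (\<lambda>n. ereal (x n)) = liminf (\<lambda>n. ereal (y n))"
proof -
  have lim: "(\<lambda>n. ereal (x n - y n)) \<longlonglongrightarrow> 0"
    using assms by (simp add: zero_ereal_def)
  have eq: "(\<lambda>n. ereal (x n)) = (\<lambda>n. ereal (x n - y n) + ereal (y n))" by simp
  show "limsup (\<lambda>n. ereal (x n)) = limsup (\<lambda>n. ereal (y n))"
    unfolding eq by (subst ereal_limsup_lim_add[OF lim]) simp_all
  show "liminf (\<lambda>n. ereal (x n)) = liminf (\<lambda>n. ereal (y n))"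
    unfolding eq by (subst ereal_liminf_lim_add[OF lim]) simp_all
qed

text \<open>There is no Lipschitz bound near the end points, that is, for angles near
  \<open>pi / 2\<close>. Uniform continuity on the compact interval replaces it.\<close>

lemma arcsin_diff_null:
  fixes a b :: "nat \<Rightarrow> real"
  assumes "\<And>n. a n \<in> {-1..1}" "\<And>n. b n \<in> {-1..1}" "(\<lambda>n. a n - b n) \<longlonglongrightarrow> 0"
  shows "(\<lambda>n. arcsin (a n) - arcsin (b n)) \<longlonglongrightarrow> 0"
proof -
  have "uniformly_continuous_on {-1..1::real} arcsin"
    by (intro compact_uniformly_continuous continuous_on_arcsin') simp
  then have "(\<lambda>n. dist (arcsin (a n)) (arcsin (b n))) \<longlonglongrightarrow> 0"
    using assms unfolding uniformly_continuous_on_sequentially dist_real_def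
    by (simp add: tendsto_rabs_zero_iff)
  then show ?thesis by (simp add: dist_real_def tendsto_rabs_zero_iff)
qed

text \<open>\<open>gap_perturb\<close> bounds the difference from above, and from below after
  exchanging the primed and the unprimed spaces. This is why gaps in both orders are assumed to
  vanish in the limit.\<close>

lemma gap_diff_null:
  fixes V W V' W' :: "nat \<Rightarrow> 'a::euclidean_space set"
  assumes "\<And>n. subspace (V n)" "\<And>n. subspace (W n)" "\<And>n. subspace (V' n)" "\<And>n. subspace (W' n)"
    and "\<And>n. 0 < dim (V n)" "\<And>n. 0 < dim (W n)" "\<And>n. 0 < dim (V' n)" "\<And>n. 0 < dim (W' n)"
    and "(\<lambda>n. gap (V n) (V' n)) \<longlonglongrightarrow> 0" "(\<lambda>n. gap (V' n) (V n)) \<longlonglongrightarrow> 0"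
    and "(\<lambda>n. gap (W n) (W' n)) \<longlonglongrightarrow> 0" "(\<lambda>n. gap (W' n) (W n)) \<longlonglongrightarrow> 0"
  shows "(\<lambda>n. gap (V n) (W n) - gap (V' n) (W' n)) \<longlonglongrightarrow> 0"
proof (rule tendsto_sandwich)
  show "\<forall>\<^sub>F n in sequentially. - (2 * gap (W n) (W' n) + 4 * gap (V' n) (V n))
      \<le> gap (V n) (W n) - gap (V' n) (W' n)"
    using gap_perturb[of "V' _" "W' _" "V _" "W _"] assms
    by (intro always_eventually allI) (smt (verit))
  show "\<forall>\<^sub>F n in sequentially. gap (V n) (W n) - gap (V' n) (W' n)
      \<le> 2 * gap (W' n) (W n) + 4 * gap (V n) (V' n)"
    using gap_perturb[of "V _" "W _" "V' _" "W' _"] assms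
    by (intro always_eventually allI) (smt (verit))
  show "(\<lambda>n. - (2 * gap (W n) (W' n) + 4 * gap (V' n) (V n))) \<longlonglongrightarrow> 0"
    using assms by (auto intro!: tendsto_eq_intros)
  show "(\<lambda>n. 2 * gap (W' n) (W n) + 4 * gap (V n) (V' n)) \<longlonglongrightarrow> 0"
    using assms by (auto intro!: tendsto_eq_intros)
qed

text \<open>The hypothesis measures the error against \<open>F n w\<close>, which is the gap in one
  order. For the other order it must be measured against \<open>F n (G w)\<close>; when
  \<open>\<epsilon> n < 1 / 2\<close>, the triangle inequality makes the two norms comparable up to
  a factor 2.\<close>

lemma dominated_difference:
  fixes F :: "nat \<Rightarrow> 'a::euclidean_space \<Rightarrow> 'a"
  assumes F: "\<And>n. linear (F n)" and inj: "\<And>n. inj (F n)"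
    and G: "linear G" and T: "subspace T" and d: "0 < dim T" and \<epsilon>: "\<epsilon> \<longlonglongrightarrow> 0"
    and le: "\<And>n w. w \<in> T \<Longrightarrow> norm (F n (w - G w)) \<le> \<epsilon> n * norm (F n w)"
  shows "dim (G ` T) = dim T"
    and "(\<lambda>n. gap (F n ` G ` T) (F n ` T)) \<longlonglongrightarrow> 0"
    and "(\<lambda>n. gap (F n ` T) (F n ` G ` T)) \<longlonglongrightarrow> 0"
proof -
  have ev: "\<forall>\<^sub>F n in sequentially. \<epsilon> n < 1 / 2"
    using \<epsilon> by (rule order_tendstoD) simp
  have F0: "F n x = 0 \<longleftrightarrow> x = 0" for n x
    using linear_injective_0[OF F[of n]] inj[of n] linear_0[OF F[of n]] by blast
  have low: "norm (F n w) \<le> 2 * norm (F n (G w))" if "\<epsilon> n < 1 / 2" "w \<in> T" for n w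
  proof -
    have "norm (F n w) \<le> norm (F n (w - G w)) + norm (F n (G w))"
      using norm_triangle_ineq[of "F n (w - G w)" "F n (G w)"] linear_diff[OF F] by simp
    moreover have "norm (F n (w - G w)) \<le> 1 / 2 * norm (F n w)"
      using le[OF that(2), of n] mult_right_mono[of "\<epsilon> n" "1 / 2" "norm (F n w)"] that(1) by simp
    ultimately show ?thesis by simp
  qed
  \<comment> \<open>A single time suffices for injectivity, because \<open>G\<close> does not depend
    on \<open>n\<close>: at \<open>n0\<close>, \<open>G w = 0\<close> forces
    \<open>F n0 w = 0\<close> and so \<open>w = 0\<close>.\<close>
  obtain n0 where n0: "\<epsilon> n0 < 1 / 2"
    using ev eventually_happens'[OF sequentially_bot] by blast
  have "inj_on G T"
    unfolding linear_inj_on_iff_eq_0[OF G T]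
    using low[OF n0] F0 by (force simp: linear_0[OF F])
  then show dimG: "dim (G ` T) = dim T"
    using dim_image_eq[OF G] span_eq_iff[of T] T by metis
  have dimF: "dim (F n ` X) = dim X" for n X
    using dim_image_eq[OF F] inj_on_subset[OF inj subset_UNIV] by blast
  have sub: "subspace (F n ` T)" "subspace (F n ` G ` T)" for n
    using F G T by (auto intro!: linear_subspace_image)
  have pos: "0 < dim (F n ` T)" "0 < dim (F n ` G ` T)" for n
    using d by (simp_all add: dimF dimG)
  have g1: "gap (F n ` G ` T) (F n ` T) \<le> \<epsilon> n" for n
  proof (rule gap_le[OF sub(1) pos(1)])
    fix x assume "x \<in> F n ` T"
    then obtain w where w: "w \<in> T" "x = F n w" by blast
    have "infdist x (F n ` G ` T) \<le> dist x (F n (G w))"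
      using w(1) by (intro infdist_le) blast
    also have "\<dots> \<le> \<epsilon> n * norm x"
      using le[OF w(1), of n] w(2) linear_diff[OF F] by (simp add: dist_norm)
    finally show "infdist x (F n ` G ` T) \<le> \<epsilon> n * norm x" .
  qed
  have eps0: "0 \<le> \<epsilon> n" for n
    using g1[of n] gap_nonneg[OF sub(2) sub(1) pos(1), of n n] by simp
  have g2: "gap (F n ` T) (F n ` G ` T) \<le> 2 * \<epsilon> n" if "\<epsilon> n < 1 / 2" for n
  proof (rule gap_le[OF sub(2) pos(2)])
    fix x assume "x \<in> F n ` G ` T"
    then obtain w where w: "w \<in> T" "x = F n (G w)" by blast
    have "infdist x (F n ` T) \<le> dist x (F n w)"
      using w(1) by (intro infdist_le) blast
    also have "\<dots> \<le> \<epsilon> n * norm (F n w)"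
      using le[OF w(1), of n] w(2) linear_diff[OF F] by (simp add: dist_norm norm_minus_commute)
    also have "\<dots> \<le> \<epsilon> n * (2 * norm x)"
      using low[OF that w(1)] w(2) eps0 by (intro mult_left_mono) auto
    finally show "infdist x (F n ` T) \<le> 2 * \<epsilon> n * norm x" by simp
  qed
  show "(\<lambda>n. gap (F n ` G ` T) (F n ` T)) \<longlonglongrightarrow> 0"
    by (rule tendsto_sandwich[OF _ _ tendsto_const \<epsilon>])
      (auto intro!: always_eventually gap_nonneg g1 sub pos)
  have \<epsilon>2: "(\<lambda>n. 2 * \<epsilon> n) \<longlonglongrightarrow> 0" using tendsto_mult_left[OF \<epsilon>, of 2] by simp
  show "(\<lambda>n. gap (F n ` T) (F n ` G ` T)) \<longlonglongrightarrow> 0"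
  proof (rule tendsto_sandwich[OF _ _ tendsto_const \<epsilon>2])
    show "\<forall>\<^sub>F n in sequentially. 0 \<le> gap (F n ` T) (F n ` G ` T)"
      by (intro always_eventually allI gap_nonneg sub pos)
    show "\<forall>\<^sub>F n in sequentially. gap (F n ` T) (F n ` G ` T) \<le> 2 * \<epsilon> n"
      using ev by eventually_elim (rule g2)
  qed
qed

section \<open>The solution operator and exponential dichotomies\<close>

lemma solution_op_refl: "solution_op A n n = Finite_Cartesian_Product.mat 1"
  by (simp add: solution_op_def)

lemma solution_op_Suc: "solution_op A (Suc n) 0 = A n ** solution_op A n 0"
  by (simp add: solution_op_def)

lemma matrix_inv_mult_left:
  fixes B :: "real^'d^'d"
  assumes "invertible B"
  shows "matrix_inv B ** B = Finite_Cartesian_Product.mat 1"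
  using assms unfolding invertible_def matrix_inv_def by (rule someI2_ex) blast

lemma foldr_matrix_mult:
  fixes B :: "nat \<Rightarrow> real^'d^'d"
  shows "foldr (\<lambda>k X. B k ** X) ks Y = foldr (\<lambda>k X. B k ** X) ks (Finite_Cartesian_Product.mat 1) ** Y"
  by (induction ks) (simp_all add: matrix_mul_assoc)

text \<open>The inverse product grows at its right end, while the fold multiplies from the left;
  \<open>foldr_matrix_mult\<close> extracts the innermost factor.\<close>

lemma solution_op_0_Suc:
  fixes A :: "nat \<Rightarrow> real^'d^'d"
  shows "solution_op A 0 (Suc n) = solution_op A 0 n ** matrix_inv (A n)"
proof -
  \<comment> \<open>For \<open>m = 0\<close> the definition takes its forward branch; both branches
    then give the identity.\<close>
  have eq: "solution_op A 0 m =
      foldr (\<lambda>k X. matrix_inv (A k) ** X) [0..<m] (Finite_Cartesian_Product.mat 1)" for m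
    by (cases m) (simp_all add: solution_op_def)
  have "foldr (\<lambda>k X. matrix_inv (A k) ** X) [0..<Suc n] (Finite_Cartesian_Product.mat 1) =
      foldr (\<lambda>k X. matrix_inv (A k) ** X) [0..<n] (matrix_inv (A n))"
    by simp
  then show ?thesis unfolding eq by (subst (asm) foldr_matrix_mult) simp
qed

lemma solution_op_inverse:
  fixes A :: "nat \<Rightarrow> real^'d^'d"
  assumes "\<And>n. invertible (A n)"
  shows "solution_op A 0 n ** solution_op A n 0 = Finite_Cartesian_Product.mat 1"
proof (induction n)
  case 0
  then show ?case by (simp add: solution_op_refl)
next
  case (Suc n)
  have "solution_op A 0 (Suc n) ** solution_op A (Suc n) 0 =
      solution_op A 0 n ** (matrix_inv (A n) ** A n) ** solution_op A n 0"
    unfolding solution_op_Suc solution_op_0_Suc by (simp add: matrix_mul_assoc)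
  also have "\<dots> = solution_op A 0 n ** solution_op A n 0"
    by (simp add: matrix_inv_mult_left assms)
  finally show ?case using Suc by simp
qed

lemma solution_op_scaled:
  "solution_op (scaled \<gamma> A) n 0 *v x = (1 / \<gamma>) ^ n *\<^sub>R (solution_op A n 0 *v x)"
proof (induction n)
  case 0
  then show ?case by (simp add: solution_op_refl)
next
  case (Suc n)
  have "solution_op (scaled \<gamma> A) (Suc n) 0 *v x = scaled \<gamma> A n *v (solution_op (scaled \<gamma> A) n 0 *v x)"
    by (simp add: solution_op_Suc matrix_vector_mul_assoc)
  also have "\<dots> = (1 / \<gamma>) *\<^sub>R (A n *v ((1 / \<gamma>) ^ n *\<^sub>R (solution_op A n 0 *v x)))"
    unfolding Suc scaled_def by (rule scaleR_matrix_vector_assoc[symmetric])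
  also have "\<dots> = (1 / \<gamma>) ^ Suc n *\<^sub>R (A n *v (solution_op A n 0 *v x))"
    by (simp add: matrix_vector_mult_scaleR)
  finally show ?case by (simp add: solution_op_Suc matrix_vector_mul_assoc)
qed

lemma invertible_scaled:
  fixes A :: "nat \<Rightarrow> real^'d^'d"
  assumes "invertible (A n)" "0 < \<gamma>"
  shows "invertible (scaled \<gamma> A n)"
  unfolding scaled_def using assms by (intro scalar_invertible) auto

lemma norm_le_spectral_norm: "norm (M *v x) \<le> spectral_norm M * norm x"
  by (rule onorm[OF matrix_vector_mul_bounded_linear])

lemma exp_dichotomy_commute:
  assumes "0 < \<gamma>" and "exp_dichotomy (solution_op (scaled \<gamma> A)) Q"
  shows "Q n *v (solution_op A n 0 *v x) = solution_op A n 0 *v (Q 0 *v x)"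
proof -
  have "Q n *v (solution_op (scaled \<gamma> A) n 0 *v x) = solution_op (scaled \<gamma> A) n 0 *v (Q 0 *v x)"
    using assms(2) unfolding exp_dichotomy_def matrix_vector_mul_assoc by metis
  then show ?thesis
    using assms(1) by (simp add: solution_op_scaled matrix_vector_mult_scaleR)
qed

text \<open>The stable estimate at \<open>m = n\<close>, where the solution operator is the identity
  and the power of the rate is 1.\<close>

lemma exp_dichotomy_bounded:
  assumes "exp_dichotomy (solution_op B) Q"
  shows "\<exists>K\<ge>0. \<forall>n x. norm (Q n *v x) \<le> K * norm x"
proof -
  obtain K \<alpha> where K: "0 < K"
    and le: "\<And>n m. m \<le> n \<Longrightarrow> spectral_norm (solution_op B n m ** Q m) \<le> K * \<alpha> ^ (n - m)"
    using assms unfolding exp_dichotomy_def by blast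
  have "norm (Q n *v x) \<le> K * norm x" for n x
    using order_trans[OF norm_le_spectral_norm mult_right_mono[OF le[of n n] norm_ge_zero]]
    by (simp add: solution_op_refl)
  then show ?thesis using K less_imp_le by blast
qed

text \<open>Both estimates of the dichotomy are scaled by the same power of \<open>\<gamma>\<close>, which cancels: solutions
  in the stable range are dominated by those in the kernel.\<close>

lemma exp_dichotomy_domination:
  fixes A :: "nat \<Rightarrow> real^'d^'d"
  assumes inv: "\<And>n. invertible (A n)" and \<gamma>: "0 < \<gamma>"
    and ed: "exp_dichotomy (solution_op (scaled \<gamma> A)) Q"
  shows "\<exists>K\<ge>0. \<exists>q\<in>{0<..<1}. \<forall>n z u. Q 0 *v z = z \<longrightarrow> Q 0 *v u = 0 \<longrightarrow>
    norm (solution_op A n 0 *v z) * norm u \<le> K * q ^ n * (norm z * norm (solution_op A n 0 *v u))"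
proof -
  let ?B = "scaled \<gamma> A"
  obtain K \<alpha>s \<alpha>u where K: "0 < K" and \<alpha>: "\<alpha>s \<in> {0<..<1}" "\<alpha>u \<in> {0<..<1}"
    and le: "\<And>n m. m \<le> n \<Longrightarrow> spectral_norm (solution_op ?B n m ** Q m) \<le> K * \<alpha>s ^ (n - m)"
    and le': "\<And>n m. m \<le> n \<Longrightarrow>
      spectral_norm (solution_op ?B m n ** compl_proj (Q n)) \<le> K * \<alpha>u ^ (n - m)"
    using ed unfolding exp_dichotomy_def by blast
  have invB: "invertible (?B n)" for n using invertible_scaled inv \<gamma> by blast
  have dom: "norm (solution_op A n 0 *v z) * norm u
      \<le> K\<^sup>2 * (\<alpha>s * \<alpha>u) ^ n * (norm z * norm (solution_op A n 0 *v u))"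
    if z: "Q 0 *v z = z" and u: "Q 0 *v u = 0" for n z u
  proof -
    define c where "c = (1 / \<gamma>) ^ n"
    have c: "0 < c" using \<gamma> by (simp add: c_def)
    have B: "solution_op ?B n 0 *v x = c *\<^sub>R (solution_op A n 0 *v x)" for x
      by (simp add: solution_op_scaled c_def)
    have "norm (solution_op ?B n 0 *v (Q 0 *v z)) \<le> K * \<alpha>s ^ n * norm z"
      using order_trans[OF norm_le_spectral_norm mult_right_mono[OF le[of 0 n] norm_ge_zero]]
      by (simp add: matrix_vector_mul_assoc)
    then have 1: "c * norm (solution_op A n 0 *v z) \<le> K * \<alpha>s ^ n * norm z"
      using c by (simp add: z B)
    have "compl_proj (Q n) *v (solution_op ?B n 0 *v u) = solution_op ?B n 0 *v u"
      using exp_dichotomy_commute[OF \<gamma> ed, of n u]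
      by (simp add: compl_proj_def matrix_vector_mult_diff_rdistrib B matrix_vector_mult_scaleR u)
    \<comment> \<open>The evolved \<open>u\<close> stays in the kernel of \<open>Q n\<close>, so the
      complementary projector fixes it, and \<open>u\<close> is recovered by going back to time 0.
      The backward estimate thereby bounds the growth of \<open>u\<close> from below.\<close>
    then have "u = (solution_op ?B 0 n ** compl_proj (Q n)) *v (solution_op ?B n 0 *v u)"
      using solution_op_inverse[of ?B n, OF invB]
      by (simp add: matrix_vector_mul_assoc[symmetric])
        (simp add: matrix_vector_mul_assoc)
    then have 2: "norm u \<le> K * \<alpha>u ^ n * (c * norm (solution_op A n 0 *v u))"
      using order_trans[OF norm_le_spectral_norm mult_right_mono[OF le'[of 0 n] norm_ge_zero],
          of "solution_op ?B n 0 *v u"] c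
      by (simp add: B)
    have "c * norm (solution_op A n 0 *v z) * norm u
        \<le> (K * \<alpha>s ^ n * norm z) * (K * \<alpha>u ^ n * (c * norm (solution_op A n 0 *v u)))"
      using 1 2 K \<alpha> by (intro mult_mono[OF 1 2]) auto
    then have "c * (norm (solution_op A n 0 *v z) * norm u)
        \<le> c * (K\<^sup>2 * (\<alpha>s * \<alpha>u) ^ n * (norm z * norm (solution_op A n 0 *v u)))"
      by (simp add: power2_eq_square power_mult_distrib mult_ac)
    then show ?thesis using c by (rule mult_left_le_imp_le)
  qed
  have "\<alpha>s * \<alpha>u \<in> {0<..<1}" using \<alpha> mult_strict_mono[of \<alpha>s 1 \<alpha>u 1] by simp
  moreover have "0 \<le> K\<^sup>2" by simp
  ultimately show ?thesis using dom by blast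
qed

section \<open>Trace spaces\<close>

text \<open>Two sequences of spaces with vanishing mutual gaps have asymptotically equal gaps
  between successive times; \<open>arcsin\<close> and averaging preserve this.\<close>

lemma angle_sum_diff_null:
  fixes A :: "nat \<Rightarrow> real^'d^'d" and V T :: "(real^'d) set"
  assumes inj: "\<And>n. inj ((*v) (solution_op A n 0))"
    and V: "subspace V" and T: "subspace T" and d: "dim V = dim T" "0 < dim T"
    and g: "(\<lambda>n. gap ((*v) (solution_op A n 0) ` V) ((*v) (solution_op A n 0) ` T)) \<longlonglongrightarrow> 0"
      "(\<lambda>n. gap ((*v) (solution_op A n 0) ` T) ((*v) (solution_op A n 0) ` V)) \<longlonglongrightarrow> 0"
  shows "(\<lambda>n. 1 / real n * angle_sum A n V - 1 / real n * angle_sum A n T) \<longlonglongrightarrow> 0"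
proof -
  let ?F = "\<lambda>n. (*v) (solution_op A n 0)"
  have F: "linear (?F n)" for n by (rule matrix_vector_mul_linear)
  have sub: "subspace (?F n ` V)" "subspace (?F n ` T)" for n
    by (intro linear_subspace_image F V T)+
  have "dim (?F n ` X) = dim X" for n X
    using dim_image_eq[OF F] inj_on_subset[OF inj subset_UNIV] by blast
  then have dims: "dim (?F n ` V) = dim T" "dim (?F n ` T) = dim T" for n
    using d(1) by auto
  have arcs: "angle (?F n ` X) (?F m ` X) = arcsin (gap (?F n ` X) (?F m ` X))"
    if "X \<in> {V, T}" for n m X
    using that by (elim insertE) (auto intro!: angle_eq_arcsin_gap sub simp: dims d(2))
  have rng: "gap (?F n ` X) (?F m ` X) \<in> {-1..1}" if "X \<in> {V, T}" for n m X
  proof -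
    have "0 \<le> gap (?F n ` X) (?F m ` X)" "gap (?F n ` X) (?F m ` X) \<le> 1"
      using that by (elim insertE; auto intro!: gap_nonneg gap_le_1 sub simp: dims d(2))+
    then show ?thesis by simp
  qed
  have "(\<lambda>n. gap (?F n ` V) (?F (Suc n) ` V) - gap (?F n ` T) (?F (Suc n) ` T)) \<longlonglongrightarrow> 0"
    by (rule gap_diff_null) (simp_all only: sub dims d(2) g g[THEN LIMSEQ_Suc])
  then have "(\<lambda>n. angle (?F n ` V) (?F (Suc n) ` V) - angle (?F n ` T) (?F (Suc n) ` T)) \<longlonglongrightarrow> 0"
    unfolding arcs[OF insertI1] arcs[OF insertI2[OF singletonI]]
    by (intro arcsin_diff_null rng) auto
  \<comment> \<open>Shift to the indexing of \<open>angle_sum\<close>. At \<open>j = 0\<close>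
    truncated subtraction compares the time 0 with itself, which does not affect the limit, and the
    sum starts at 1.\<close>
  then have "(\<lambda>j. angle (?F (j - 1) ` V) (?F j ` V) - angle (?F (j - 1) ` T) (?F j ` T)) \<longlonglongrightarrow> 0"
    by (subst filterlim_sequentially_Suc[symmetric]) simp
  from cesaro_null[OF this] show ?thesis
    by (simp add: angle_sum_def sum_subtractf right_diff_distrib)
qed

section \<open>The flags of the dichotomy projectors and the spectral fibers\<close>

locale dichotomy_flag =
  fixes A :: "nat \<Rightarrow> real^'d^'d" and l :: nat and \<sigma>m \<sigma>p :: "nat \<Rightarrow> real"
    and P :: "nat \<Rightarrow> nat \<Rightarrow> real^'d^'d"
  assumes inv: "invertible (A n)"
    and spec: "spectral_intervals A l \<sigma>m \<sigma>p"
    and proj: "dichotomy_projectors A l \<sigma>m \<sigma>p P"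
begin

abbreviation \<Phi> :: "nat \<Rightarrow> real^'d \<Rightarrow> real^'d" where
  "\<Phi> n \<equiv> (*v) (solution_op A n 0)"

abbreviation S :: "nat \<Rightarrow> nat \<Rightarrow> real^'d \<Rightarrow> real^'d" where
  "S n i \<equiv> (*v) (P n i)"

lemma linear_\<Phi>: "linear (\<Phi> n)" and linear_S: "linear (S n i)"
  by (rule matrix_vector_mul_linear)+

lemma inj_\<Phi>: "inj (\<Phi> n)"
  using solution_op_inverse[of A n, OF inv]
  by (metis injI matrix_vector_mul_assoc matrix_vector_mul_lid)

text \<open>Induction along the ordered end points, starting from the convention
  \<open>\<sigma>p (l + 1) = 0\<close>. It ensures that each resolvent interval contains a positive
  \<open>\<gamma>\<close>.\<close>

lemma sigma_nonneg: "1 \<le> i \<Longrightarrow> i \<le> l + 1 \<Longrightarrow> 0 \<le> \<sigma>p i"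
proof (induction "l + 1 - i" arbitrary: i)
  case 0
  then have "i = l + 1" by simp
  then show ?case using spec by (simp add: spectral_intervals_def)
next
  case (Suc k)
  then have "0 \<le> \<sigma>p (i + 1)" "i \<in> {1..l}" by auto
  moreover from this have "\<sigma>p (i + 1) < \<sigma>m i" "\<sigma>m i \<le> \<sigma>p i"
    using spec unfolding spectral_intervals_def by blast+
  ultimately show ?case by linarith
qed

text \<open>One positive \<open>\<gamma>\<close> per resolvent interval is enough: the projectors do
  not depend on it, and the consequences drawn below concern the unscaled solution operator. A point
  beyond \<open>\<sigma>p 1\<close> or the midpoint of a gap serves.\<close>

lemma dichotomy:
  assumes i: "1 \<le> i" "i \<le> l + 1"
  obtains \<gamma> where "0 < \<gamma>" "exp_dichotomy (solution_op (scaled \<gamma> A)) (\<lambda>n. P n i)"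
proof -
  have "\<exists>\<gamma>\<in>resolvent_interval \<sigma>m \<sigma>p i. 0 < \<gamma>"
  proof (cases "i = 1")
    case True
    have "\<sigma>p 1 + 1 \<in> resolvent_interval \<sigma>m \<sigma>p i" "0 < \<sigma>p 1 + 1"
      using True sigma_nonneg[of 1] by (auto simp: resolvent_interval_def)
    then show ?thesis by blast
  next
    case False
    then have "i - 1 \<in> {1..l}" "i - 1 + 1 = i" using i by auto
    then have "\<sigma>p i < \<sigma>m (i - 1)" using spec unfolding spectral_intervals_def by metis
    then have "(\<sigma>p i + \<sigma>m (i - 1)) / 2 \<in> resolvent_interval \<sigma>m \<sigma>p i"
        "0 < (\<sigma>p i + \<sigma>m (i - 1)) / 2"
      using False sigma_nonneg[OF i] by (auto simp: resolvent_interval_def)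
    then show ?thesis by blast
  qed
  then obtain \<gamma> where "\<gamma> \<in> resolvent_interval \<sigma>m \<sigma>p i" "0 < \<gamma>" by blast
  moreover have "i \<in> {1..l + 1}" using i by simp
  moreover have "\<forall>i\<in>{1..l + 1}. \<forall>\<gamma>\<in>resolvent_interval \<sigma>m \<sigma>p i.
      exp_dichotomy (solution_op (scaled \<gamma> A)) (\<lambda>n. P n i)"
    using proj unfolding dichotomy_projectors_def by (rule conjunct1)
  ultimately show thesis using that by blast
qed

lemma S_idem:
  assumes "1 \<le> i" "i \<le> l + 1"
  shows "S n i (S n i x) = S n i x"
proof (rule dichotomy[OF assms])
  fix \<gamma> assume "exp_dichotomy (solution_op (scaled \<gamma> A)) (\<lambda>n. P n i)"
  then have "P n i ** P n i = P n i" unfolding exp_dichotomy_def by blast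
  then show ?thesis by (simp add: matrix_vector_mul_assoc)
qed

lemma S_\<Phi>: "1 \<le> i \<Longrightarrow> i \<le> l + 1 \<Longrightarrow> S n i (\<Phi> n x) = \<Phi> n (S 0 i x)"
  by (erule (1) dichotomy) (rule exp_dichotomy_commute)

lemma S_bounded: "1 \<le> i \<Longrightarrow> i \<le> l + 1 \<Longrightarrow> \<exists>K\<ge>0. \<forall>n x. norm (S n i x) \<le> K * norm x"
  by (erule (1) dichotomy) (rule exp_dichotomy_bounded)

lemma S_domination:
  "1 \<le> i \<Longrightarrow> i \<le> l + 1 \<Longrightarrow> \<exists>K\<ge>0. \<exists>q\<in>{0<..<1}. \<forall>n z u. S 0 i z = z \<longrightarrow> S 0 i u = 0 \<longrightarrow>
    norm (\<Phi> n z) * norm u \<le> K * q ^ n * (norm z * norm (\<Phi> n u))"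
  by (erule (1) dichotomy) (rule exp_dichotomy_domination[OF inv])

lemma compl_proj_mult: "compl_proj (P n i) *v x = x - S n i x"
  by (simp add: compl_proj_def matrix_vector_mult_diff_rdistrib)

lemma range_S_iff:
  assumes "1 \<le> i" "i \<le> l + 1"
  shows "x \<in> range (S n i) \<longleftrightarrow> S n i x = x"
  using S_idem[OF assms, of n] by (auto intro: range_eqI[OF sym])

lemma range_compl_proj_iff:
  assumes "1 \<le> i" "i \<le> l + 1"
  shows "x \<in> range ((*v) (compl_proj (P n i))) \<longleftrightarrow> S n i x = 0"
proof
  show "S n i x = 0" if "x \<in> range ((*v) (compl_proj (P n i)))"
    using that S_idem[OF assms] by (auto simp: compl_proj_mult matrix_vector_mult_diff_distrib)
  show "x \<in> range ((*v) (compl_proj (P n i)))" if "S n i x = 0"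
    using that compl_proj_mult[of n i x] by (metis diff_zero rangeI)
qed

lemma S_first: "S n 1 x = x"
proof -
  have "x \<in> range (S n 1)" using proj unfolding dichotomy_projectors_def by blast
  then show ?thesis by (simp add: range_S_iff)
qed

lemma S_last: "S n (l + 1) x = 0"
  using proj rangeI[of "S n (l + 1)" x] unfolding dichotomy_projectors_def by blast

text \<open>The first identity encodes nested ranges, the second nested kernels. Together they make
  \<open>S n i - S n (i + 1)\<close> the projector onto the \<open>i\<close>-th fiber.\<close>

lemma S_Suc:
  assumes i: "1 \<le> i" "i \<le> l"
  shows "S n i (S n (i + 1) x) = S n (i + 1) x" and "S n (i + 1) (S n i x) = S n (i + 1) x"
proof -
  have "range (S n (i + 1)) \<subseteq> range (S n i)"
    using proj i unfolding dichotomy_projectors_def by simp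
  then show "S n i (S n (i + 1) x) = S n (i + 1) x"
    using range_S_iff[of i] i by (meson le_add1 order_trans rangeI subsetD)
  have "range ((*v) (compl_proj (P n i))) \<subseteq> range ((*v) (compl_proj (P n (i + 1))))"
    using proj i unfolding dichotomy_projectors_def by simp
  moreover have "x - S n i x \<in> range ((*v) (compl_proj (P n i)))"
    by (metis compl_proj_mult rangeI)
  ultimately have "x - S n i x \<in> range ((*v) (compl_proj (P n (i + 1))))" by blast
  then show "S n (i + 1) (S n i x) = S n (i + 1) x"
    using range_compl_proj_iff[of "i + 1"] i by (simp add: matrix_vector_mult_diff_distrib)
qed

lemma fiber_iff:
  "1 \<le> i \<Longrightarrow> i \<le> l \<Longrightarrow> x \<in> fiber P n i \<longleftrightarrow> S n i x = x \<and> S n (i + 1) x = 0"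
  unfolding fiber_def using range_S_iff[of i x n] range_compl_proj_iff[of "i + 1" x n] by simp

lemma subspace_fiber: "subspace (fiber P n i)"
  unfolding fiber_def
  by (intro subspace_inter linear_subspace_image) (auto simp: matrix_vector_mul_linear)

text \<open>The fixed point equation passes down the nested ranges from \<open>i\<close> to
  \<open>j\<close>, the kernel equation up the nested kernels from \<open>i + 1\<close> to
  \<open>j\<close>.\<close>

lemma S_fiber:
  assumes i: "1 \<le> i" "i \<le> l" and x: "x \<in> fiber P n i" and j: "1 \<le> j" "j \<le> l + 1"
  shows "S n j x = (if j \<le> i then x else 0)"
proof (cases "j \<le> i")
  case True
  have "i \<le> l \<longrightarrow> S n j x = x" if "S n i x = x"
    using True that
  proof (induction rule: dec_induct)
    case (step k)
    then show ?case using S_Suc(1)[of k n x] j by (metis Suc_eq_plus1 Suc_leD le_trans)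
  qed simp
  then show ?thesis using True i x by (simp add: fiber_iff)
next
  case False
  then have "i + 1 \<le> j" by simp
  then have "j \<le> l + 1 \<longrightarrow> S n j x = 0"
  proof (induction rule: dec_induct)
    case base
    then show ?case using i x by (simp add: fiber_iff)
  next
    case (step k)
    then show ?case using S_Suc(2)[of k n x] i
      by (auto simp: linear_0[OF linear_S])
  qed
  then show ?thesis using False j by simp
qed

text \<open>By \<open>S_fiber\<close>, \<open>S n j\<close> keeps exactly the summands of index at
  least \<open>j\<close>, so consecutive projectors differ by one summand. This shows that sums over
  fibers are direct.\<close>

lemma fiber_component:
  assumes w: "\<And>i. i \<in> {1..l} \<Longrightarrow> w i \<in> fiber P n i" and j: "j \<in> {1..l}"
  shows "S n j (\<Sum>i=1..l. w i) - S n (j + 1) (\<Sum>i=1..l. w i) = w j"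
proof -
  have "S n k (\<Sum>i=1..l. w i) = (\<Sum>i=1..l. if k \<le> i then w i else 0)" if "1 \<le> k" "k \<le> l + 1" for k
    unfolding linear_sum[OF linear_S] using w S_fiber[of _ "w _" n k] that by (intro sum.cong) auto
  then have "S n j (\<Sum>i=1..l. w i) - S n (j + 1) (\<Sum>i=1..l. w i) =
      (\<Sum>i=1..l. (if j \<le> i then w i else 0) - (if j + 1 \<le> i then w i else 0))"
    using j by (simp add: sum_subtractf)
  also have "\<dots> = (\<Sum>i=1..l. if i = j then w i else 0)"
    by (intro sum.cong) auto
  finally show ?thesis using j by simp
qed

text \<open>The projectors commute with the evolution, and \<open>\<Phi> n\<close> is bijective.
  Hence the angle sum of an initial fiber is the sum over the moving fibers.\<close>

lemma image_\<Phi>_fiber: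
  assumes i: "1 \<le> i" "i \<le> l"
  shows "\<Phi> n ` fiber P 0 i = fiber P n i"
proof safe
  fix x assume "x \<in> fiber P 0 i"
  then show "\<Phi> n x \<in> fiber P n i"
    using i S_\<Phi>[of i n x] S_\<Phi>[of "i + 1" n x] by (simp add: fiber_iff linear_0[OF linear_\<Phi>])
next
  fix y assume y: "y \<in> fiber P n i"
  have "surj (\<Phi> n)" by (rule linear_inj_imp_surj[OF linear_\<Phi> inj_\<Phi>])
  then obtain x where x: "y = \<Phi> n x" by blast
  have "\<Phi> n (S 0 i x) = \<Phi> n x" "\<Phi> n (S 0 (i + 1) x) = \<Phi> n 0"
    using y i S_\<Phi>[of i n x] S_\<Phi>[of "i + 1" n x] unfolding x
    by (simp_all add: fiber_iff linear_0[OF linear_\<Phi>])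
  then have "x \<in> fiber P 0 i"
    unfolding fiber_iff[OF i] using injD[OF inj_\<Phi>] by blast
  then show "y \<in> \<Phi> n ` fiber P 0 i" using x by blast
qed

section \<open>The trace space of a fixed subspace\<close>

context
  fixes V :: "(real^'d) set"
  assumes V: "subspace V"
begin

definition section_at :: "nat \<Rightarrow> (real^'d) set" where
  "section_at i = {x \<in> V. S 0 i x = x}"

text \<open>A copy of the quotient of \<open>section_at i\<close> by
  \<open>section_at (i + 1)\<close>: for indices from 1 to \<open>l\<close> the latter is the kernel
  of the map on the former.\<close>

definition trace_part :: "nat \<Rightarrow> (real^'d) set" where
  "trace_part i = (\<lambda>x. x - S 0 (i + 1) x) ` section_at i"

lemma linear_id_minus_S: "linear (\<lambda>x. x - S n i x)"
  by (intro linear_compose_sub linear_S linear_id[unfolded id_def])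

lemma subspace_section: "subspace (section_at i)"
  using V unfolding section_at_def subspace_def
  by (auto simp: linear_0[OF linear_S] linear_add[OF linear_S] linear_cmul[OF linear_S])

lemma subspace_trace_part: "subspace (trace_part i)"
  unfolding trace_part_def by (intro linear_subspace_image linear_id_minus_S subspace_section)

lemma trace_part_subset:
  assumes i: "1 \<le> i" "i \<le> l"
  shows "trace_part i \<subseteq> fiber P 0 i"
proof
  fix w assume "w \<in> trace_part i"
  then obtain x where x: "S 0 i x = x" "w = x - S 0 (i + 1) x"
    by (auto simp: trace_part_def section_at_def)
  then have "S 0 i w = w" using S_Suc(1)[OF i, of 0 x] by (simp add: matrix_vector_mult_diff_distrib)
  moreover have "S 0 (i + 1) w = 0"
    using S_idem[of "i + 1" 0 x] i by (simp add: x(2) matrix_vector_mult_diff_distrib)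
  ultimately show "w \<in> fiber P 0 i" using fiber_iff[OF i] by simp
qed

lemma trace_space_eq: "trace_space l P V = (\<Sum>i=1..l. trace_part i)"
proof -
  have "range (S 0 i) \<inter> V = section_at i" if "i \<in> {1..l}" for i
  proof (rule Set.set_eqI)
    show "x \<in> range (S 0 i) \<inter> V \<longleftrightarrow> x \<in> section_at i" for x
      using that range_S_iff[of i x 0] by (simp add: section_at_def conj_commute)
  qed
  then show ?thesis
    unfolding trace_space_alt[OF proj spec V] trace_part_def
    by (intro sum.cong) (simp_all add: compl_proj_mult)
qed

lemma section_first: "section_at 1 = V"
  using S_first by (simp add: section_at_def)

lemma section_last: "section_at (l + 1) = {0}"
  using S_last subspace_0[OF V] by (auto simp: section_at_def)

lemma section_diff:
  assumes i: "1 \<le> i" "i \<le> l" and x: "x \<in> section_at i" "y \<in> section_at i"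
    and eq: "x - S 0 (i + 1) x = y - S 0 (i + 1) y"
  shows "x - y \<in> section_at (i + 1)"
proof -
  have "x - y \<in> V" using x V by (simp add: section_at_def subspace_diff)
  moreover have "S 0 (i + 1) (x - y) = x - y"
    using eq by (simp add: matrix_vector_mult_diff_distrib algebra_simps)
  ultimately show ?thesis by (simp add: section_at_def)
qed

text \<open>A lift from the quotient back into \<open>V\<close>. Linearity makes it bounded and lets
  the lifts be assembled into one linear map.\<close>

lemma section_right_inverse:
  "\<exists>f. linear f \<and> range f \<subseteq> section_at i \<and> (\<forall>w\<in>trace_part i. f w - S 0 (i + 1) (f w) = w)"
  using linear_exists_right_inverse_on[OF linear_id_minus_S[of 0 "i + 1"] subspace_section[of i]]
  unfolding trace_part_def by blast

text \<open>\<open>section_at i\<close> is the direct sum of the lifted trace part and the next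
  section, since two elements with the same trace differ by an element of the next section.\<close>

lemma dim_section:
  assumes i: "1 \<le> i" "i \<le> l"
  shows "dim (section_at i) = dim (trace_part i) + dim (section_at (i + 1))"
proof -
  obtain f where f: "linear f" "range f \<subseteq> section_at i"
      "\<And>w. w \<in> trace_part i \<Longrightarrow> f w - S 0 (i + 1) (f w) = w"
    using section_right_inverse by blast
  let ?L = "\<lambda>x. x - S 0 (i + 1) x"
  have sub: "section_at (i + 1) \<subseteq> section_at i"
    unfolding section_at_def
  proof (intro Collect_mono impI conjI)
    fix x assume x: "x \<in> V \<and> S 0 (i + 1) x = x"
    then show "x \<in> V" ..
    show "S 0 i x = x" using S_Suc(1)[OF i, of 0 x] x by simp
  qed
  have "inj_on f (trace_part i)" by (rule inj_on_inverseI[of _ ?L]) (rule f(3))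
  then have dimf: "dim (f ` trace_part i) = dim (trace_part i)"
    using dim_image_eq[OF f(1)] subspace_trace_part span_eq_iff by metis
  have "f ` trace_part i \<inter> section_at (i + 1) = {0}"
  proof safe
    fix w assume w: "w \<in> trace_part i" "f w \<in> section_at (i + 1)"
    then have "w = 0" using f(3)[OF w(1)] by (simp add: section_at_def)
    then show "f w = 0" using linear_0[OF f(1)] by simp
  next
    show "0 \<in> f ` trace_part i"
      using linear_0[OF f(1)] subspace_0[OF subspace_trace_part] by (metis imageI)
  qed (rule subspace_0[OF subspace_section])
  moreover have "{x + y |x y. x \<in> f ` trace_part i \<and> y \<in> section_at (i + 1)} = section_at i"
  proof safe
    fix w y assume "w \<in> trace_part i" "y \<in> section_at (i + 1)"
    then show "f w + y \<in> section_at i"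
      using f(2) sub subspace_add[OF subspace_section[of i]] by blast
  next
    fix x assume x: "x \<in> section_at i"
    then have w: "?L x \<in> trace_part i" by (simp add: trace_part_def)
    then have "x - f (?L x) \<in> section_at (i + 1)"
      using f(2) f(3)[OF w] x by (intro section_diff[OF i]) auto
    then show "\<exists>a b. x = a + b \<and> a \<in> f ` trace_part i \<and> b \<in> section_at (i + 1)"
      using w by (intro exI[of _ "f (?L x)"] exI[of _ "x - f (?L x)"]) auto
  qed
  ultimately have "dim (section_at i) + dim {0::real^'d} = dim (f ` trace_part i) + dim (section_at (i + 1))"
    using dim_sums_Int[of "f ` trace_part i" "section_at (i + 1)"]
      linear_subspace_image[OF f(1) subspace_trace_part] subspace_section by metis
  then show ?thesis using dimf by simp
qed

lemma sum_dim_trace_part: "(\<Sum>i=1..l. dim (trace_part i)) = dim V"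
proof -
  have "k \<le> l \<Longrightarrow> (\<Sum>i=1..k. dim (trace_part i)) + dim (section_at (k + 1)) = dim V" for k
  proof (induction k)
    case 0
    then show ?case using section_first by simp
  next
    case (Suc k)
    then show ?case using dim_section[of "Suc k"] by simp
  qed
  from this[of l] show ?thesis using section_last by simp
qed

text \<open>A vector \<open>w\<close> of the \<open>i\<close>-th part is approximated by a vector of \<open>V\<close> that differs from it by an
  element of the faster decaying stable range.\<close>

lemma trace_part_approx:
  assumes i: "1 \<le> i" "i \<le> l"
  shows "\<exists>f \<epsilon>. linear f \<and> range f \<subseteq> section_at i \<and>
    (\<forall>w\<in>trace_part i. f w - S 0 (i + 1) (f w) = w) \<and>
    \<epsilon> \<longlonglongrightarrow> 0 \<and> (\<forall>n. 0 \<le> \<epsilon> n) \<and>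
    (\<forall>n. \<forall>w\<in>trace_part i. norm (\<Phi> n (w - f w)) \<le> \<epsilon> n * norm (\<Phi> n w))"
proof -
  obtain f where f: "linear f" "range f \<subseteq> section_at i"
      "\<And>w. w \<in> trace_part i \<Longrightarrow> f w - S 0 (i + 1) (f w) = w"
    using section_right_inverse by blast
  obtain K where K: "0 \<le> K" "\<And>n x. norm (S n (i + 1) x) \<le> K * norm x"
    using S_bounded[of "i + 1"] i by auto
  obtain D q where D: "0 \<le> D" and q: "q \<in> {0<..<1}"
    and dom: "\<And>n z u. S 0 (i + 1) z = z \<Longrightarrow> S 0 (i + 1) u = 0 \<Longrightarrow>
      norm (\<Phi> n z) * norm u \<le> D * q ^ n * (norm z * norm (\<Phi> n u))"
    using S_domination[of "i + 1"] i by auto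
  obtain B where B: "0 < B" "\<And>w. norm (f w) \<le> B * norm w"
    using linear_bounded_pos[OF f(1)] by blast
  \<comment> \<open>\<open>B\<close> bounds the lift, \<open>K\<close> the projector that extracts
    the error from it, and \<open>D * q ^ n\<close> is the domination of the evolved error by the
    evolved \<open>w\<close>.\<close>
  define \<epsilon> where "\<epsilon> n = D * (K * B) * q ^ n" for n
  have "\<epsilon> \<longlonglongrightarrow> 0"
    unfolding \<epsilon>_def using q by (intro tendsto_mult_right_zero LIMSEQ_realpow_zero) auto
  moreover have \<epsilon>0: "0 \<le> \<epsilon> n" for n
    unfolding \<epsilon>_def using D K(1) B(1) q by auto
  moreover have "norm (\<Phi> n (w - f w)) \<le> \<epsilon> n * norm (\<Phi> n w)" if w: "w \<in> trace_part i" for n w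
  proof (cases "w = 0")
    case True
    then show ?thesis by (simp add: linear_0[OF f(1)])
  next
    case False
    define z where "z = S 0 (i + 1) (f w)"
    have "w - f w = - z" using f(3)[OF w] by (simp add: z_def algebra_simps)
    then have wz: "norm (\<Phi> n (w - f w)) = norm (\<Phi> n z)"
      by (simp add: linear_neg[OF linear_\<Phi>])
    have "norm (f w) \<le> B * norm w" by (rule B(2))
    then have "norm z \<le> K * (B * norm w)"
      unfolding z_def using K by (meson mult_left_mono order_trans)
    then have "norm z * norm (\<Phi> n w) \<le> K * (B * norm w) * norm (\<Phi> n w)"
      by (intro mult_right_mono) auto
    then have "D * q ^ n * (norm z * norm (\<Phi> n w)) \<le> D * q ^ n * (K * (B * norm w) * norm (\<Phi> n w))"
      using D q by (intro mult_left_mono) auto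
    moreover have "S 0 (i + 1) z = z" "S 0 (i + 1) w = 0"
      using trace_part_subset[OF i] w fiber_iff[OF i] S_idem[of "i + 1"] i by (auto simp: z_def)
    ultimately have "norm (\<Phi> n z) * norm w \<le> D * q ^ n * (K * (B * norm w) * norm (\<Phi> n w))"
      using dom order_trans by blast
    then have "norm (\<Phi> n z) * norm w \<le> (\<epsilon> n * norm (\<Phi> n w)) * norm w"
      by (simp add: \<epsilon>_def mult_ac)
    then show ?thesis unfolding wz using False by (simp add: mult_le_cancel_right)
  qed
  ultimately show ?thesis using f by blast
qed

lemma mem_trace_space_iff:
  "x \<in> trace_space l P V \<longleftrightarrow> (\<exists>w. x = (\<Sum>i=1..l. w i) \<and> (\<forall>i\<in>{1..l}. w i \<in> trace_part i))"
  unfolding trace_space_eq by (auto simp: set_sum_alt)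

lemma subspace_trace_space: "subspace (trace_space l P V)"
proof -
  have "subspace (\<Sum>i\<in>I. trace_part i)" if "finite I" for I
    using that
  proof (induction I rule: finite_induct)
    case empty
    then show ?case by (simp add: set_zero)
  next
    case (insert i I)
    have "trace_part i + (\<Sum>i\<in>I. trace_part i) =
        {x + y |x y. x \<in> trace_part i \<and> y \<in> (\<Sum>i\<in>I. trace_part i)}"
      unfolding set_plus_def by blast
    then show ?case
      using subspace_sums[OF subspace_trace_part insert.IH] insert.hyps by simp
  qed
  then show ?thesis unfolding trace_space_eq by simp
qed

text \<open>The lifts of the single parts are added up. Their errors are relative to the evolved
  components, and these are controlled by the evolved vector because the projectors are bounded
  uniformly in time.\<close>

lemma trace_space_approx:
  "\<exists>G \<epsilon>. linear G \<and> G ` trace_space l P V = V \<and> \<epsilon> \<longlonglongrightarrow> 0 \<and>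
    (\<forall>n. \<forall>w\<in>trace_space l P V. norm (\<Phi> n (w - G w)) \<le> \<epsilon> n * norm (\<Phi> n w))"
proof -
  have "\<forall>i. \<exists>f \<epsilon>. i \<in> {1..l} \<longrightarrow> linear f \<and> range f \<subseteq> section_at i \<and>
    (\<forall>w\<in>trace_part i. f w - S 0 (i + 1) (f w) = w) \<and>
    \<epsilon> \<longlonglongrightarrow> 0 \<and> (\<forall>n. 0 \<le> \<epsilon> n) \<and>
    (\<forall>n. \<forall>w\<in>trace_part i. norm (\<Phi> n (w - f w)) \<le> \<epsilon> n * norm (\<Phi> n w))"
    using trace_part_approx by auto
  then obtain f \<epsilon> where f\<epsilon>: "\<forall>i. i \<in> {1..l} \<longrightarrow> linear (f i) \<and> range (f i) \<subseteq> section_at i \<and>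
    (\<forall>w\<in>trace_part i. f i w - S 0 (i + 1) (f i w) = w) \<and>
    \<epsilon> i \<longlonglongrightarrow> 0 \<and> (\<forall>n. 0 \<le> \<epsilon> i n) \<and>
    (\<forall>n. \<forall>w\<in>trace_part i. norm (\<Phi> n (w - f i w)) \<le> \<epsilon> i n * norm (\<Phi> n w))"
    by metis
  have lin_f: "linear (f i)" and f_section: "f i w \<in> section_at i"
    and f_inverse: "w \<in> trace_part i \<Longrightarrow> f i w - S 0 (i + 1) (f i w) = w"
    and \<epsilon>_null: "\<epsilon> i \<longlonglongrightarrow> 0" and \<epsilon>_nonneg: "0 \<le> \<epsilon> i n"
    and f_close: "w \<in> trace_part i \<Longrightarrow> norm (\<Phi> n (w - f i w)) \<le> \<epsilon> i n * norm (\<Phi> n w)"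
    if "i \<in> {1..l}" for i n w
    using f\<epsilon> that by blast+
  have "\<forall>i. \<exists>K. 1 \<le> i \<and> i \<le> l + 1 \<longrightarrow> 0 \<le> K \<and> (\<forall>n x. norm (S n i x) \<le> K * norm x)"
    using S_bounded by blast
  then obtain K where K: "\<And>i. 1 \<le> i \<Longrightarrow> i \<le> l + 1 \<Longrightarrow> 0 \<le> K i \<and> (\<forall>n x. norm (S n i x) \<le> K i * norm x)"
    by metis
  \<comment> \<open>\<open>G\<close> lifts each fiber component of its argument. The component maps
    are linear on the whole space, so no decomposition has to be chosen.\<close>
  define G where "G x = (\<Sum>i=1..l. f i (S 0 i x - S 0 (i + 1) x))" for x
  \<comment> \<open>\<open>K i + K (i + 1)\<close> bounds the component map
    \<open>S n i - S n (i + 1)\<close> for all \<open>n\<close>.\<close>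
  define \<delta> where "\<delta> n = (\<Sum>i=1..l. \<epsilon> i n * (K i + K (i + 1)))" for n
  have G_sum: "G (\<Sum>i=1..l. w i) = (\<Sum>i=1..l. f i (w i))"
    if "\<And>i. i \<in> {1..l} \<Longrightarrow> w i \<in> trace_part i" for w
    unfolding G_def
    using that trace_part_subset by (intro sum.cong arg_cong[of _ _ "f _"] fiber_component) auto
  have "linear G"
    unfolding G_def
    by (intro linear_compose_sum ballI linear_compose[OF linear_compose_sub[OF linear_S linear_S],
          unfolded o_def] lin_f)
  moreover have "\<delta> \<longlonglongrightarrow> 0"
    unfolding \<delta>_def using \<epsilon>_null by (intro tendsto_null_sum tendsto_mult_left_zero) auto
  moreover have "norm (\<Phi> n (x - G x)) \<le> \<delta> n * norm (\<Phi> n x)" if "x \<in> trace_space l P V" for n x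
  proof -
    obtain w where x: "x = (\<Sum>i=1..l. w i)" and w: "\<And>i. i \<in> {1..l} \<Longrightarrow> w i \<in> trace_part i"
      using \<open>x \<in> _\<close> unfolding mem_trace_space_iff by blast
    have part: "norm (\<Phi> n (w i)) \<le> (K i + K (i + 1)) * norm (\<Phi> n x)" if i: "i \<in> {1..l}" for i
    proof -
      have "w i = S 0 i x - S 0 (i + 1) x"
        unfolding x using w i trace_part_subset by (intro fiber_component[symmetric]) auto
      then have "\<Phi> n (w i) = S n i (\<Phi> n x) - S n (i + 1) (\<Phi> n x)"
        using i by (simp add: S_\<Phi> linear_diff[OF linear_\<Phi>])
      then have "norm (\<Phi> n (w i)) \<le> norm (S n i (\<Phi> n x)) + norm (S n (i + 1) (\<Phi> n x))"
        by (simp only: norm_triangle_ineq4)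
      also have "\<dots> \<le> K i * norm (\<Phi> n x) + K (i + 1) * norm (\<Phi> n x)"
        using K[of i] K[of "i + 1"] i by (intro add_mono) auto
      finally show ?thesis by (simp add: distrib_right)
    qed
    have "G x = (\<Sum>i=1..l. f i (w i))" unfolding x using w by (rule G_sum)
    then have "x - G x = (\<Sum>i=1..l. w i - f i (w i))" by (simp add: x sum_subtractf)
    then have "\<Phi> n (x - G x) = (\<Sum>i=1..l. \<Phi> n (w i - f i (w i)))"
      by (simp only: linear_sum[OF linear_\<Phi>])
    then have "norm (\<Phi> n (x - G x)) \<le> (\<Sum>i=1..l. norm (\<Phi> n (w i - f i (w i))))"
      by (simp add: norm_sum)
    also have "\<dots> \<le> (\<Sum>i=1..l. \<epsilon> i n * norm (\<Phi> n (w i)))"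
      using f_close w by (intro sum_mono) blast
    also have "\<dots> \<le> (\<Sum>i=1..l. \<epsilon> i n * ((K i + K (i + 1)) * norm (\<Phi> n x)))"
      using part \<epsilon>_nonneg by (intro sum_mono mult_left_mono) auto
    finally show ?thesis by (simp add: \<delta>_def sum_distrib_right mult.assoc)
  qed
  moreover have "G ` trace_space l P V = V"
  proof safe
    fix x assume "x \<in> trace_space l P V"
    have "f i y \<in> V" if "i \<in> {1..l}" for i y
      using f_section[OF that] by (simp add: section_at_def)
    then show "G x \<in> V" unfolding G_def by (intro subspace_sum V) auto
  next
    fix v assume v: "v \<in> V"
    \<comment> \<open>A preimage of \<open>v\<close> is built by descending the flag: the trace of
      the current remainder is lifted and subtracted, which puts the remainder into the next
      section. After \<open>l\<close> steps it lies in \<open>section_at (l + 1)\<close>, which is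
      trivial.\<close>
    have "k \<le> l \<Longrightarrow> \<exists>w. (\<forall>i\<in>{1..k}. w i \<in> trace_part i) \<and>
        v - (\<Sum>i=1..k. f i (w i)) \<in> section_at (k + 1)" for k
    proof (induction k)
      case 0
      then show ?case using v section_first by simp
    next
      case (Suc k)
      then obtain w where w: "\<forall>i\<in>{1..k}. w i \<in> trace_part i"
          "v - (\<Sum>i=1..k. f i (w i)) \<in> section_at (Suc k)"
        unfolding Suc_eq_plus1 by (meson Suc_leD Suc_eq_plus1 add_leD1)
      let ?r = "v - (\<Sum>i=1..k. f i (w i))" and ?k = "Suc k"
      let ?u = "?r - S 0 (?k + 1) ?r"
      let ?w = "w(?k := ?u)"
      have k: "?k \<in> {1..l}" using Suc.prems by simp
      have u: "?u \<in> trace_part ?k" using w(2) by (simp add: trace_part_def)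
      have "?r - f ?k ?u \<in> section_at (?k + 1)"
        using f_inverse[OF k u] f_section[OF k] w(2) k by (intro section_diff) auto
      moreover have "(\<Sum>i=1..k. f i (?w i)) = (\<Sum>i=1..k. f i (w i))"
        by (intro sum.cong) auto
      then have "(\<Sum>i=1..?k. f i (?w i)) = (\<Sum>i=1..k. f i (w i)) + f ?k ?u"
        by (subst sum.nat_ivl_Suc') (simp_all add: add.commute)
      ultimately have "v - (\<Sum>i=1..?k. f i (?w i)) \<in> section_at (?k + 1)"
        by (simp only: diff_diff_eq)
      moreover have "\<forall>i\<in>{1..?k}. ?w i \<in> trace_part i"
        using w(1) u by (auto simp: le_Suc_eq)
      ultimately show ?case by blast
    qed
    then obtain w where w: "\<forall>i\<in>{1..l}. w i \<in> trace_part i"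
        "v - (\<Sum>i=1..l. f i (w i)) \<in> section_at (l + 1)"
      by blast
    have "G (\<Sum>i=1..l. w i) = (\<Sum>i=1..l. f i (w i))" using w(1) by (intro G_sum) blast
    then have "v = G (\<Sum>i=1..l. w i)" using w(2) unfolding section_last by simp
    moreover have "(\<Sum>i=1..l. w i) \<in> trace_space l P V"
      unfolding mem_trace_space_iff using w(1) by blast
    ultimately show "v \<in> G ` trace_space l P V" by blast
  qed
  ultimately show ?thesis by blast
qed

lemma dim_trace_space_and_angle_sum:
  assumes d: "0 < dim V"
  shows "dim (trace_space l P V) = dim V"
    and "(\<lambda>n. 1 / real n * angle_sum A n V - 1 / real n * angle_sum A n (trace_space l P V)) \<longlonglongrightarrow> 0"
proof -
  let ?T = "trace_space l P V"
  obtain G \<epsilon> where G: "linear G" "G ` ?T = V" "\<epsilon> \<longlonglongrightarrow> 0"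
      "\<And>n w. w \<in> ?T \<Longrightarrow> norm (\<Phi> n (w - G w)) \<le> \<epsilon> n * norm (\<Phi> n w)"
    using trace_space_approx by blast
  \<comment> \<open>\<open>G\<close> maps onto \<open>V\<close>, so the trace space is nontrivial.
    Equality of the dimensions follows only afterwards, from the domination.\<close>
  have dT: "0 < dim ?T"
    using dim_image_le[OF G(1), of ?T] d G(2) by simp
  have dd: "dim V = dim ?T"
      "(\<lambda>n. gap (\<Phi> n ` V) (\<Phi> n ` ?T)) \<longlonglongrightarrow> 0" "(\<lambda>n. gap (\<Phi> n ` ?T) (\<Phi> n ` V)) \<longlonglongrightarrow> 0"
    using dominated_difference[where F = \<Phi> and G = G and T = ?T and \<epsilon> = \<epsilon>]
    by (simp_all only: linear_\<Phi> inj_\<Phi> G subspace_trace_space dT)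
  show "dim ?T = dim V" using dd(1) by simp
  show "(\<lambda>n. 1 / real n * angle_sum A n V - 1 / real n * angle_sum A n ?T) \<longlonglongrightarrow> 0"
    by (rule angle_sum_diff_null[OF inj_\<Phi> V subspace_trace_space dd(1) dT dd(2,3)])
qed

end

section \<open>Passage to the suprema\<close>

lemma trace_space_mem_trace_spaces:
  assumes "V \<in> grassmannian s" "0 < s"
  shows "trace_space l P V \<in> trace_spaces l P s"
proof -
  have V: "subspace V" "dim V = s" using assms by (auto simp: grassmannian_def)
  have "trace_space l P V \<in> grassmannian s"
    using subspace_trace_space[OF V(1)] dim_trace_space_and_angle_sum(1)[OF V(1)] V(2) assms(2)
    by (simp add: grassmannian_def)
  moreover have "\<forall>i\<in>{1..l}. subspace (trace_part V i) \<and> trace_part V i \<subseteq> fiber P 0 i"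
    using subspace_trace_part[OF V(1)] trace_part_subset[OF V(1)] by simp
  ultimately show ?thesis
    unfolding trace_spaces_def using trace_space_eq[OF V(1)] sum_dim_trace_part[OF V(1)] V(2) by blast
qed

lemma limsup_liminf_trace_space:
  assumes "V \<in> grassmannian s" "0 < s"
  shows "limsup (\<lambda>n. ereal (1 / real n * angle_sum A n V)) =
      limsup (\<lambda>n. ereal (1 / real n * angle_sum A n (trace_space l P V)))"
    and "liminf (\<lambda>n. ereal (1 / real n * angle_sum A n V)) =
      liminf (\<lambda>n. ereal (1 / real n * angle_sum A n (trace_space l P V)))"
  using limsup_liminf_eq_if_diff_null[OF dim_trace_space_and_angle_sum(2)[of V]] assms
  by (simp_all add: grassmannian_def)

text \<open>Trace spaces form a subset of the Grassmannian, and replacing \<open>V\<close> by its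
  trace space leaves the value of \<open>h\<close> unchanged.\<close>

lemma SUP_grassmannian_eq_SUP_trace_spaces:
  fixes h :: "(real^'d) set \<Rightarrow> ereal"
  assumes "0 < s" and h: "\<And>V. V \<in> grassmannian s \<Longrightarrow> h V = h (trace_space l P V)"
  shows "(SUP V\<in>grassmannian s. h V) = (SUP V\<in>trace_spaces l P s. h V)"
proof (rule antisym)
  show "(SUP V\<in>grassmannian s. h V) \<le> (SUP V\<in>trace_spaces l P s. h V)"
    using trace_space_mem_trace_spaces assms by (intro SUP_mono) (metis order_refl)
  show "(SUP V\<in>trace_spaces l P s. h V) \<le> (SUP V\<in>grassmannian s. h V)"
    by (intro SUP_subset_mono) (auto simp: trace_spaces_def)
qed

section \<open>One-dimensional fibers\<close>

text \<open>Dimensions that sum to 1 leave a single nontrivial summand, which is a line inside a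
  line and therefore fills its fiber.\<close>

lemma trace_spaces_1:
  assumes fib: "\<And>i. i \<in> {1..l} \<Longrightarrow> dim (fiber P 0 i) = 1"
  shows "trace_spaces l P 1 = fiber P 0 ` {1..l}"
proof safe
  fix V assume "V \<in> trace_spaces l P 1"
  then obtain W where W: "\<And>i. i \<in> {1..l} \<Longrightarrow> subspace (W i)" "\<And>i. i \<in> {1..l} \<Longrightarrow> W i \<subseteq> fiber P 0 i"
      "V = (\<Sum>i=1..l. W i)" "(\<Sum>i=1..l. dim (W i)) = 1"
    unfolding trace_spaces_def by blast
  then obtain i where i: "i \<in> {1..l}" "dim (W i) = 1"
      "\<And>j. j \<in> {1..l} \<Longrightarrow> j \<noteq> i \<Longrightarrow> dim (W j) = 0"
    using sum_eq_1_iff[of "{1..l}" "\<lambda>i. dim (W i)"] by auto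
  \<comment> \<open>Here \<open>0\<close> is the set \<open>{0}\<close>, the neutral element of
    Minkowski addition.\<close>
  have zero: "W j = 0" if "j \<in> {1..l} - {i}" for j
    using that i(3)[of j] subspace_0[OF W(1)[of j]] by (auto simp: set_zero)
  have "V = W i + (\<Sum>j\<in>{1..l} - {i}. W j)"
    unfolding W(3) using i(1) by (intro sum.remove) auto
  also have "(\<Sum>j\<in>{1..l} - {i}. W j) = 0" by (intro sum.neutral ballI zero)
  finally have "V = W i" by simp
  moreover have "W i = fiber P 0 i"
    using i(1,2) fib[OF i(1)] W subspace_fiber by (intro subspace_dim_equal) auto
  ultimately show "V \<in> fiber P 0 ` {1..l}" using i(1) by blast
next
  fix i assume i: "i \<in> {1..l}"
  let ?W = "\<lambda>j. if j = i then fiber P 0 i else 0"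
  have "(\<Sum>j=1..l. ?W j) = fiber P 0 i" using i by simp
  moreover have "(\<Sum>j=1..l. dim (?W j)) = (\<Sum>j=1..l. if j = i then 1 else 0)"
    using fib[OF i] by (intro sum.cong) (auto simp: set_zero)
  then have "(\<Sum>j=1..l. dim (?W j)) = 1" using i by simp
  moreover have "\<forall>j\<in>{1..l}. subspace (?W j) \<and> ?W j \<subseteq> fiber P 0 j"
    using subspace_fiber subspace_0[OF subspace_fiber] by (auto simp: set_zero)
  ultimately show "fiber P 0 i \<in> trace_spaces l P 1"
    unfolding trace_spaces_def grassmannian_def using subspace_fiber fib[OF i]
    by (intro CollectI conjI exI[of _ ?W]) simp_all
qed

lemma angle_sum_fiber:
  assumes "i \<in> {1..l}"
  shows "angle_sum A n (fiber P 0 i) = (\<Sum>j=1..n. angle (fiber P (j - 1) i) (fiber P j i))"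
  using assms by (simp add: angle_sum_def image_\<Phi>_fiber)

text \<open>If \<open>l\<close> were smaller than the dimension of the space, the index
  \<open>l + 1\<close> would be covered by the assumption; but the projector of that index vanishes,
  so its fiber is trivial.\<close>

lemma spectral_count_one_dimensional:
  assumes "\<And>i. i \<in> {1..CARD('d)} \<Longrightarrow> dim (fiber P 0 i) = 1"
  shows "l = CARD('d)"
proof (rule ccontr)
  assume "l \<noteq> CARD('d)"
  moreover have "l \<le> CARD('d)" using spec by (simp add: spectral_intervals_def)
  ultimately have "dim (fiber P 0 (l + 1)) = 1" by (intro assms) auto
  moreover have "fiber P 0 (l + 1) \<subseteq> {0}"
    unfolding fiber_def using proj by (auto simp: dichotomy_projectors_def)
  then have "dim (fiber P 0 (l + 1)) = 0" by simp
  ultimately show False by simp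
qed

end

theorem theorem3p6:
  fixes A :: "nat \<Rightarrow> real^'d^'d" and l :: nat and \<sigma>m \<sigma>p :: "nat \<Rightarrow> real"
    and P :: "nat \<Rightarrow> nat \<Rightarrow> real^'d^'d"
  assumes inv: "\<forall>n. invertible (A n)"
    and bdd: "\<exists>C. \<forall>n. spectral_norm (A n) \<le> C \<and> spectral_norm (matrix_inv (A n)) \<le> C"
    and spec: "spectral_intervals A l \<sigma>m \<sigma>p"
    and proj: "dichotomy_projectors A l \<sigma>m \<sigma>p P"
  shows
    "(\<forall>s\<in>{1..CARD('d)}.
        (\<forall>V\<in>grassmannian s.
           limsup (\<lambda>n. ereal (1 / real n * angle_sum A n V)) =
             limsup (\<lambda>n. ereal (1 / real n * angle_sum A n (trace_space l P V))) \<and>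
           liminf (\<lambda>n. ereal (1 / real n * angle_sum A n V)) =
             liminf (\<lambda>n. ereal (1 / real n * angle_sum A n (trace_space l P V)))) \<and>
        upper_angular_value A s =
          (SUP V\<in>trace_spaces l P s. limsup (\<lambda>n. ereal (1 / real n * angle_sum A n V))) \<and>
        lower_angular_value A s =
          (SUP V\<in>trace_spaces l P s. liminf (\<lambda>n. ereal (1 / real n * angle_sum A n V)))) \<and>
     ((\<forall>i\<in>{1..CARD('d)}. \<forall>m. dim (fiber P m i) = 1) \<longrightarrow>
        l = CARD('d) \<and>
        lower_angular_value A 1 =
          (MAX i\<in>{1..CARD('d)}. liminf (\<lambda>n. ereal (1 / real n *
             (\<Sum>j=1..n. angle (fiber P (j - 1) i) (fiber P j i))))) \<and>
        upper_angular_value A 1 =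
          (MAX i\<in>{1..CARD('d)}. limsup (\<lambda>n. ereal (1 / real n *
             (\<Sum>j=1..n. angle (fiber P (j - 1) i) (fiber P j i))))))"
proof -
  interpret dichotomy_flag A l \<sigma>m \<sigma>p P
    using inv spec proj by unfold_locales auto
  have sup: "upper_angular_value A s =
      (SUP V\<in>trace_spaces l P s. limsup (\<lambda>n. ereal (1 / real n * angle_sum A n V)))"
    "lower_angular_value A s =
      (SUP V\<in>trace_spaces l P s. liminf (\<lambda>n. ereal (1 / real n * angle_sum A n V)))"
    if "0 < s" for s
    unfolding upper_angular_value_def lower_angular_value_def
    by (rule SUP_grassmannian_eq_SUP_trace_spaces[OF that],
        erule limsup_liminf_trace_space[OF _ that])+
  show ?thesis
  proof (intro conjI ballI impI)
    fix s and V :: "(real^'d) set" assume "s \<in> {1..CARD('d)}" "V \<in> grassmannian s"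
    then show "limsup (\<lambda>n. ereal (1 / real n * angle_sum A n V)) =
        limsup (\<lambda>n. ereal (1 / real n * angle_sum A n (trace_space l P V)))"
      "liminf (\<lambda>n. ereal (1 / real n * angle_sum A n V)) =
        liminf (\<lambda>n. ereal (1 / real n * angle_sum A n (trace_space l P V)))"
      using limsup_liminf_trace_space by auto
  next
    assume fib: "\<forall>i\<in>{1..CARD('d)}. \<forall>m. dim (fiber P m i) = 1"
    show l: "l = CARD('d)" using fib by (intro spectral_count_one_dimensional) auto
    have one: "0 < (1::nat)" by simp
    have traces: "trace_spaces l P 1 = fiber P 0 ` {1..l}"
      using fib l by (intro trace_spaces_1) auto
    \<comment> \<open>The index set is finite and nonempty, so the supremum is attained.\<close>
    have max: "(SUP i\<in>{1..l}. h i) = (MAX i\<in>{1..CARD('d)}. h i)" for h :: "nat \<Rightarrow> ereal"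
      unfolding l by (intro Max_Sup[symmetric]) auto
    show "lower_angular_value A 1 =
        (MAX i\<in>{1..CARD('d)}. liminf (\<lambda>n. ereal (1 / real n *
           (\<Sum>j=1..n. angle (fiber P (j - 1) i) (fiber P j i)))))"
      unfolding sup(2)[OF one] traces image_image max[symmetric]
      by (intro SUP_cong refl) (simp add: angle_sum_fiber)
    show "upper_angular_value A 1 =
        (MAX i\<in>{1..CARD('d)}. limsup (\<lambda>n. ereal (1 / real n *
           (\<Sum>j=1..n. angle (fiber P (j - 1) i) (fiber P j i)))))"
      unfolding sup(1)[OF one] traces image_image max[symmetric]
      by (intro SUP_cong refl) (simp add: angle_sum_fiber)
  qed (rule sup, simp)+
qed

end
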